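(* Consider, for a metric $g_{\mu\nu}$, a scalar $\sigma$ and a $U(1)$ gauge potential $A_\mu$ in four spacetime dimensions, with $\gamma$ and $k$ constants, the field equations $$R_{\mu\nu}-\frac12 g_{\mu\nu}R=\frac12\partial_\mu\sigma\,\partial_\nu\sigma-\frac12 g_{\mu\nu}\left(\frac12(\partial\sigma)^2-4k^2e^\sigma\right)+\frac12e^{\gamma\sigma}\left(F_{\mu\alpha}F_\nu{}^{\alpha}-\frac14g_{\mu\nu}F^2\right),$$ $$\nabla_\mu\left(e^{\gamma\sigma}F^{\mu\nu}\right)=0,\qquad \Box\sigma=-4k^2e^\sigma+\frac14\gamma\,e^{\gamma\sigma}F^2 .$$ Take the ansatz, in coordinates $(t,r,x,y)$, $$ds^2=-b(r)\,dt^2+a(r)\,dr^2+r^2(dx^2+dy^2),\qquad b(r)=\frac{r^2}{a(r)},\qquad \sigma=-2\log(kr).$$ On this ansatz the Maxwell equation $\nabla_\mu(e^{\gamma\sigma}F^{\mu\nu})=0$ is solved by $$A_t=-\frac{C}{2\gamma}(kr)^{2\gamma},\qquad A_r=A_x=A_y=0,$$ with $C$ a nonzero constant. With this gauge potential, the requirement that the remaining equations of motion be simultaneously satisfied dictates that $$\gamma=-1,\qquad a(r)=\frac{1}{1-\frac{r_h^2}{r^2}+\frac{Q^2}{4r^4}},\qquad b(r)=r^2\left(1-\frac{r_h^2}{r^2}+\frac{Q^2}{4r^4}\right),$$ where $r_h$ is a constant and $Q=\frac{C}{\sqrt2\,k}$. Thus the charged linear dilaton black hole has line element $$ds^2=-r^2\left(1-\frac{r_h^2}{r^2}+\frac{Q^2}{4r^4}\right)dt^2+\frac{dr^2}{1-\frac{r_h^2}{r^2}+\frac{Q^2}{4r^4}}+r^2(dx^2+dy^2),$$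 which for $Q\to0$ reduces to the uncharged solution $-r^2\left(1-\frac{r_h^2}{r^2}\right)dt^2+\frac{dr^2}{1-r_h^2/r^2}+r^2(dx^2+dy^2)$. It admits the outer ($r_+$) and inner ($r_-$) horizons $$r_\pm=\frac{r_h}{\sqrt2}\left[1\pm\left(1-\frac{Q^2}{r_h^4}\right)^{1/2}\right]^{1/2}.$$ The two horizons coalesce when $Q=r_h^2$; for this value of the charge the black hole becomes extremal, with line element $$ds^2=-r^2\left(1-\frac{r_h^2}{2r^2}\right)^2dt^2+\frac{dr^2}{\left(1-\frac{r_h^2}{2r^2}\right)^2}+r^2(dx^2+dy^2).$$
   Context: $R_{\mu\nu}$ and $R$ are the Ricci tensor and Ricci scalar of the Lorentzian metric $g_{\mu\nu}$ (sign convention: round spheres have positive Ricci scalar), $\nabla$ is the Levi-Civita connection, $\Box=g^{\mu\nu}\nabla_\mu\nabla_\nu$, $(\partial\sigma)^2=g^{\mu\nu}\partial_\mu\sigma\,\partial_\nu\sigma$, $F_{\mu\nu}=\partial_\mu A_\nu-\partial_\nu A_\mu$, and $F^2=F_{\mu\nu}F^{\mu\nu}$. The equations are obtained by varying the action $\frac{1}{16\pi G_N}\int d^4x\sqrt{-g}\,\big(R-\frac12(\partial\sigma)^2+4k^2e^\sigma-\frac14e^{\gamma\sigma}F^2\big)$ with respect to $g_{\mu\nu}$, $A_\mu$ and $\sigma$, where $G_N$ is Newton's constant.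
   Formalization: The constant r_h in the dictated form of a and b is allowed to be complex (r_h^2 is any real number, possibly negative), since solutions with negative r_h^2 exist; r_h is shown to be real and positive whenever the solution reaches a horizon. *)

theory Defs
  imports "HOL-Analysis.Analysis"
begin

text \<open>Tensor calculus in a single coordinate chart of a four-dimensional spacetime.  Points are
  coordinate tuples in \<open>real ^ 4\<close>; the indices 1, 2, 3, 4 stand for \<open>t\<close>, \<open>r\<close>, \<open>x\<close>, \<open>y\<close>.\<close>

type_synonym point = "real ^ 4"
type_synonym metric = "point \<Rightarrow> real ^ 4 ^ 4"

definition partial :: "4 \<Rightarrow> (point \<Rightarrow> real) \<Rightarrow> point \<Rightarrow> real" where
  "partial i f p = deriv (\<lambda>s. f (p + s *\<^sub>R axis i 1)) 0"

definition minkowski :: "real ^ 4 ^ 4" where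
  "minkowski = (\<chi> i j. if i = j then (if i = 1 then - 1 else 1) else 0)"

definition lorentzian :: "real ^ 4 ^ 4 \<Rightarrow> bool" where
  "lorentzian M \<longleftrightarrow> transpose M = M \<and>
     (\<exists>P. invertible P \<and> transpose P ** M ** P = minkowski)"

definition line_element :: "metric \<Rightarrow> point \<Rightarrow> real ^ 4 \<Rightarrow> real" where
  "line_element g p v = (\<Sum>i\<in>UNIV. \<Sum>j\<in>UNIV. g p $ i $ j * v $ i * v $ j)"

abbreviation inv_metric :: "metric \<Rightarrow> metric" where
  "inv_metric g p \<equiv> matrix_inv (g p)"

text \<open>\<open>christoffel g l m n p\<close> is \<open>\<Gamma>\<close> with upper index \<open>l\<close> and lower indices \<open>m, n\<close>.\<close>

definition christoffel :: "metric \<Rightarrow> 4 \<Rightarrow> 4 \<Rightarrow> 4 \<Rightarrow> point \<Rightarrow> real" where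
  "christoffel g l m n p = (\<Sum>s\<in>UNIV. 1/2 * inv_metric g p $ l $ s *
     (partial m (\<lambda>q. g q $ s $ n) p + partial n (\<lambda>q. g q $ s $ m) p
       - partial s (\<lambda>q. g q $ m $ n) p))"

text \<open>\<open>riemann g l s m n p\<close> is the curvature tensor with upper index \<open>l\<close> and lower indices
  \<open>s, m, n\<close>, in the convention \<open>\<partial>\<^sub>m \<Gamma>\<^sup>l\<^sub>n\<^sub>s - \<partial>\<^sub>n \<Gamma>\<^sup>l\<^sub>m\<^sub>s + \<dots>\<close>; contracting \<open>l\<close> with \<open>m\<close> then gives
  round spheres positive Ricci scalar.\<close>

definition riemann :: "metric \<Rightarrow> 4 \<Rightarrow> 4 \<Rightarrow> 4 \<Rightarrow> 4 \<Rightarrow> point \<Rightarrow> real" where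
  "riemann g l s m n p =
     partial m (christoffel g l n s) p - partial n (christoffel g l m s) p
     + (\<Sum>e\<in>UNIV. christoffel g l m e p * christoffel g e n s p)
     - (\<Sum>e\<in>UNIV. christoffel g l n e p * christoffel g e m s p)"

definition ricci :: "metric \<Rightarrow> 4 \<Rightarrow> 4 \<Rightarrow> point \<Rightarrow> real" where
  "ricci g m n p = (\<Sum>l\<in>UNIV. riemann g l m l n p)"

definition ricci_scalar :: "metric \<Rightarrow> point \<Rightarrow> real" where
  "ricci_scalar g p = (\<Sum>m\<in>UNIV. \<Sum>n\<in>UNIV. inv_metric g p $ m $ n * ricci g m n p)"

definition grad_sq :: "metric \<Rightarrow> (point \<Rightarrow> real) \<Rightarrow> point \<Rightarrow> real" where
  "grad_sq g s p =
     (\<Sum>m\<in>UNIV. \<Sum>n\<in>UNIV. inv_metric g p $ m $ n * partial m s p * partial n s p)"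

definition box :: "metric \<Rightarrow> (point \<Rightarrow> real) \<Rightarrow> point \<Rightarrow> real" where
  "box g s p = (\<Sum>m\<in>UNIV. \<Sum>n\<in>UNIV. inv_metric g p $ m $ n *
     (partial m (partial n s) p - (\<Sum>l\<in>UNIV. christoffel g l m n p * partial l s p)))"

text \<open>\<open>divergence g H n\<close> is \<open>\<nabla>\<^sub>m H\<^sup>m\<^sup>n\<close> for a contravariant 2-tensor field \<open>H\<close>.\<close>

definition divergence :: "metric \<Rightarrow> (4 \<Rightarrow> 4 \<Rightarrow> point \<Rightarrow> real) \<Rightarrow> 4 \<Rightarrow> point \<Rightarrow> real" where
  "divergence g H n p = (\<Sum>m\<in>UNIV. partial m (H m n) p
     + (\<Sum>l\<in>UNIV. christoffel g m m l p * H l n p)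
     + (\<Sum>l\<in>UNIV. christoffel g n m l p * H m l p))"

definition field_strength :: "(point \<Rightarrow> real ^ 4) \<Rightarrow> 4 \<Rightarrow> 4 \<Rightarrow> point \<Rightarrow> real" where
  "field_strength A m n p = partial m (\<lambda>q. A q $ n) p - partial n (\<lambda>q. A q $ m) p"

text \<open>\<open>F_mixed g A n a\<close> is \<open>F\<^sub>n\<^sup>a\<close>, and \<open>F_upper g A m n\<close> is \<open>F\<^sup>m\<^sup>n\<close>.\<close>

definition F_mixed :: "metric \<Rightarrow> (point \<Rightarrow> real ^ 4) \<Rightarrow> 4 \<Rightarrow> 4 \<Rightarrow> point \<Rightarrow> real" where
  "F_mixed g A n a p = (\<Sum>c\<in>UNIV. inv_metric g p $ a $ c * field_strength A n c p)"

definition F_upper :: "metric \<Rightarrow> (point \<Rightarrow> real ^ 4) \<Rightarrow> 4 \<Rightarrow> 4 \<Rightarrow> point \<Rightarrow> real" where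
  "F_upper g A m n p = (\<Sum>c\<in>UNIV. inv_metric g p $ m $ c * F_mixed g A c n p)"

definition F_sq :: "metric \<Rightarrow> (point \<Rightarrow> real ^ 4) \<Rightarrow> point \<Rightarrow> real" where
  "F_sq g A p = (\<Sum>m\<in>UNIV. \<Sum>n\<in>UNIV. field_strength A m n p * F_upper g A m n p)"

definition einstein_eq ::
  "real \<Rightarrow> real \<Rightarrow> metric \<Rightarrow> (point \<Rightarrow> real ^ 4) \<Rightarrow> (point \<Rightarrow> real) \<Rightarrow> point \<Rightarrow> bool" where
  "einstein_eq k \<gamma> g A \<sigma> p \<longleftrightarrow> (\<forall>m n.
     ricci g m n p - 1/2 * g p $ m $ n * ricci_scalar g p =
       1/2 * partial m \<sigma> p * partial n \<sigma> p
       - 1/2 * g p $ m $ n * (1/2 * grad_sq g \<sigma> p - 4 * k^2 * exp (\<sigma> p))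
       + 1/2 * exp (\<gamma> * \<sigma> p) *
           ((\<Sum>a\<in>UNIV. field_strength A m a p * F_mixed g A n a p)
            - 1/4 * g p $ m $ n * F_sq g A p))"

definition maxwell_eq ::
  "real \<Rightarrow> metric \<Rightarrow> (point \<Rightarrow> real ^ 4) \<Rightarrow> (point \<Rightarrow> real) \<Rightarrow> point \<Rightarrow> bool" where
  "maxwell_eq \<gamma> g A \<sigma> p \<longleftrightarrow>
     (\<forall>n. divergence g (\<lambda>m l q. exp (\<gamma> * \<sigma> q) * F_upper g A m l q) n p = 0)"

definition scalar_eq ::
  "real \<Rightarrow> real \<Rightarrow> metric \<Rightarrow> (point \<Rightarrow> real ^ 4) \<Rightarrow> (point \<Rightarrow> real) \<Rightarrow> point \<Rightarrow> bool" where
  "scalar_eq k \<gamma> g A \<sigma> p \<longleftrightarrow>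
     box g \<sigma> p = - 4 * k^2 * exp (\<sigma> p) + 1/4 * \<gamma> * exp (\<gamma> * \<sigma> p) * F_sq g A p"

definition is_solution ::
  "real \<Rightarrow> real \<Rightarrow> point set \<Rightarrow> metric \<Rightarrow> (point \<Rightarrow> real ^ 4) \<Rightarrow> (point \<Rightarrow> real) \<Rightarrow> bool" where
  "is_solution k \<gamma> U g A \<sigma> \<longleftrightarrow> (\<forall>p\<in>U. lorentzian (g p) \<and>
     einstein_eq k \<gamma> g A \<sigma> p \<and> maxwell_eq \<gamma> g A \<sigma> p \<and> scalar_eq k \<gamma> g A \<sigma> p)"

text \<open>The ansatz; \<open>p $ 2\<close> is the radial coordinate.\<close>

definition radial_domain :: "real set \<Rightarrow> point set" where
  "radial_domain I = {p. p $ 2 \<in> I}"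

definition static_metric :: "(real \<Rightarrow> real) \<Rightarrow> (real \<Rightarrow> real) \<Rightarrow> metric" where
  "static_metric a b p = (\<chi> i j. if i = j
     then (vector [- b (p $ 2), a (p $ 2), (p $ 2)^2, (p $ 2)^2] :: real ^ 4) $ i else 0)"

definition dilaton :: "real \<Rightarrow> point \<Rightarrow> real" where
  "dilaton k p = - 2 * ln (k * p $ 2)"

definition gauge_potential :: "real \<Rightarrow> real \<Rightarrow> real \<Rightarrow> point \<Rightarrow> real ^ 4" where
  "gauge_potential k \<gamma> C p = vector [- (C / (2 * \<gamma>)) * (k * p $ 2) powr (2 * \<gamma>), 0, 0, 0]"

definition blackening :: "real \<Rightarrow> real \<Rightarrow> real \<Rightarrow> real" where
  "blackening rh Q r = 1 - rh^2 / r^2 + Q^2 / (4 * r^4)"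

definition bh_metric :: "real \<Rightarrow> real \<Rightarrow> metric" where
  "bh_metric rh Q =
     static_metric (\<lambda>r. 1 / blackening rh Q r) (\<lambda>r. r^2 * blackening rh Q r)"

text \<open>A horizon of a static metric: a radius at which the Killing field \<open>\<partial>\<^sub>t\<close> becomes null
  (\<open>g\<^sub>t\<^sub>t\<close> vanishes) and the surface of constant \<open>r\<close> becomes null (\<open>(\<partial>r)\<^sup>2 = g\<^sup>r\<^sup>r\<close> vanishes).  Both are
  stated as limits from the radii in \<open>I\<close> because the chart degenerates at the horizon itself.\<close>

definition horizon_at :: "real set \<Rightarrow> metric \<Rightarrow> real \<Rightarrow> bool" where
  "horizon_at I g r0 \<longleftrightarrow> 0 < r0 \<and> r0 islimpt I \<and>
     (\<forall>t x y. ((\<lambda>r. g (vector [t, r, x, y]) $ 1 $ 1) \<longlongrightarrow> 0) (at r0 within I) \<and>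
              ((\<lambda>r. grad_sq g (\<lambda>p. p $ 2) (vector [t, r, x, y])) \<longlongrightarrow> 0) (at r0 within I))"

text \<open>The surface gravity is the limit of \<open>|\<nabla>N|\<close> with \<open>N\<^sup>2 = - g\<^sub>t\<^sub>t\<close>, and
  \<open>|\<nabla>N|\<^sup>2 = (\<partial> g\<^sub>t\<^sub>t)\<^sup>2 / (- 4 g\<^sub>t\<^sub>t)\<close>.\<close>

definition has_surface_gravity :: "real set \<Rightarrow> metric \<Rightarrow> real \<Rightarrow> real \<Rightarrow> bool" where
  "has_surface_gravity I g r0 \<kappa> \<longleftrightarrow> 0 \<le> \<kappa> \<and>
     (\<forall>t x y. ((\<lambda>r. grad_sq g (\<lambda>p. g p $ 1 $ 1) (vector [t, r, x, y])
                    / (- 4 * g (vector [t, r, x, y]) $ 1 $ 1)) \<longlongrightarrow> \<kappa>^2) (at r0 within I))"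

definition extremal :: "real set \<Rightarrow> metric \<Rightarrow> bool" where
  "extremal I g \<longleftrightarrow> (\<exists>r0. \<forall>r. horizon_at I g r \<longleftrightarrow> r = r0) \<and>
     (\<forall>r. horizon_at I g r \<longrightarrow> has_surface_gravity I g r 0)"

definition r_plus :: "real \<Rightarrow> real \<Rightarrow> real" where
  "r_plus rh Q = rh / sqrt 2 * sqrt (1 + sqrt (1 - Q^2 / rh^4))"

definition r_minus :: "real \<Rightarrow> real \<Rightarrow> real" where
  "r_minus rh Q = rh / sqrt 2 * sqrt (1 - sqrt (1 - Q^2 / rh^4))"

end

theory Submission
  imports Defs
begin

text \<open>Put \<open>f = 1 / a\<close>, so that \<open>b = r\<^sup>2 f\<close>. With \<open>e = exp (\<gamma> \<sigma>) (A\<^sub>t')\<^sup>2 = C\<^sup>2 k\<^sup>2 (k r) powr (2 \<gamma> - 2)\<close>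
  the field equations become \<open>2 f + r f' = 2 - e / 4\<close> (components \<open>tt\<close> and \<open>rr\<close>),
  \<open>4 f + 5 r f' + r\<^sup>2 f'' = 4 + e / 2\<close> (components \<open>xx\<close> and \<open>yy\<close>) and \<open>2 f + r f' = 2 + \<gamma> e / 4\<close>
  (scalar equation). As \<open>e > 0\<close>, the first and the last force \<open>\<gamma> = - 1\<close>; then \<open>e = 2 Q\<^sup>2 / r\<^sup>4\<close>, and the first
  says that \<open>r\<^sup>2 f - r\<^sup>2 - Q\<^sup>2 / (4 r\<^sup>2)\<close> has derivative zero, hence is a constant, namely \<open>- r\<^sub>h\<^sup>2\<close>.
  Horizons are the zeros of \<open>f\<close>, and \<open>r\<^sup>4 f = (r\<^sup>2 - r\<^sub>+\<^sup>2) (r\<^sup>2 - r\<^sub>-\<^sup>2)\<close>.\<close>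

subsection \<open>Fields depending on the radial coordinate only\<close>

lemma vector_4 [simp]:
  "(vector [w, x, y, z] :: 'a::zero ^ 4) $ 1 = w"
  "(vector [w, x, y, z] :: 'a::zero ^ 4) $ 2 = x"
  "(vector [w, x, y, z] :: 'a::zero ^ 4) $ 3 = y"
  "(vector [w, x, y, z] :: 'a::zero ^ 4) $ 4 = z"
  unfolding vector_def by simp_all

text \<open>\<open>matrix_inv\<close> is a choice among two-sided inverses. For square matrices a
  right inverse is also a left inverse, and then the inverse is unique.\<close>

lemma matrix_inv_eqI:
  fixes A B :: "real ^ 'n ^ 'n"
  assumes "A ** B = mat 1"
  shows "matrix_inv A = B"
proof -
  have BA: "B ** A = mat 1"
    using assms by (simp add: matrix_left_right_inverse)
  have "A ** matrix_inv A = mat 1 \<and> matrix_inv A ** A = mat 1"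
    unfolding matrix_inv_def by (rule someI[of _ B]) (use assms BA in auto)
  then show ?thesis
    by (metis BA matrix_mul_assoc matrix_mul_lid matrix_mul_rid)
qed

text \<open>Both sides choose from the same set of derivatives, so they agree even where
  \<open>h\<close> is not differentiable.\<close>

lemma deriv_compose_shift: "deriv (\<lambda>s. h (c + s)) 0 = deriv h (c::real)"
  unfolding deriv_def using DERIV_shift[of h _ 0 c] by (simp add: add.commute)

lemma partial_radial:
  "partial m (\<lambda>q. h (q $ 2)) p = (if m = 2 then deriv h (p $ 2) else 0)"
  unfolding partial_def by (simp add: deriv_compose_shift axis_def)

text \<open>A partial derivative sees only the germ of \<open>f\<close> along one axis. As
  \<open>I\<close> is open, knowing the radial profile over \<open>I\<close> suffices. This is how
  the metric, the Christoffel symbols and the matter fields are all differentiated.\<close>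

lemma partial_eqI:
  assumes "open I" "p $ 2 \<in> I" "\<And>q. q $ 2 \<in> I \<Longrightarrow> f q = h (q $ 2)"
    and "(h has_real_derivative D) (at (p $ 2))"
  shows "partial m f p = (if m = 2 then D else 0)"
proof -
  have "open ((\<lambda>s. (p + s *\<^sub>R axis m 1) $ 2) -` I)"
    using assms(1) by (intro open_vimage) (auto intro!: continuous_intros)
  then have "\<forall>\<^sub>F s in nhds 0. s \<in> (\<lambda>s. (p + s *\<^sub>R axis m 1) $ 2) -` I"
    using assms(2) by (intro eventually_nhds_in_open) auto
  then have "\<forall>\<^sub>F s in nhds 0. f (p + s *\<^sub>R axis m 1) = h ((p + s *\<^sub>R axis m 1) $ 2)"
    by eventually_elim (use assms(3) in blast)
  then have "partial m f p = partial m (\<lambda>q. h (q $ 2)) p"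
    unfolding partial_def by (intro deriv_cong_ev) auto
  then show ?thesis
    using DERIV_imp_deriv[OF assms(4)] by (simp add: partial_radial)
qed

section \<open>Components, inverse and signature of the static metric\<close>

lemma static_metric_nth:
  "static_metric a b p $ i $ j = (if i = j then
     (if i = 1 then - b (p $ 2) else if i = 2 then a (p $ 2) else (p $ 2)^2) else 0)"
  using exhaust_4[of i] by (auto simp: static_metric_def)

lemma inv_static_metric_nth:
  assumes "a (p $ 2) \<noteq> 0" "b (p $ 2) \<noteq> 0" "p $ 2 \<noteq> 0"
  shows "inv_metric (static_metric a b) p $ i $ j = (if i = j then
     (if i = 1 then - 1 / b (p $ 2) else if i = 2 then 1 / a (p $ 2) else 1 / (p $ 2)^2) else 0)"
proof -
  \<comment> \<open>the inverse is again of the form \<^term>\<open>static_metric\<close>, at a point with radius \<open>1 / p $ 2\<close>\<close>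
  have "inv_metric (static_metric a b) p =
      static_metric (\<lambda>r. 1 / a (p $ 2)) (\<lambda>r. 1 / b (p $ 2)) (\<chi> i. 1 / p $ 2)"
    using assms
    by (intro matrix_inv_eqI)
      (simp add: vec_eq_iff forall_4 sum_4 matrix_matrix_mult_def mat_def static_metric_nth
        power2_eq_square)
  then show ?thesis
    by (simp add: static_metric_nth power2_eq_square)
qed

text \<open>If \<open>a\<close> and \<open>b\<close> have the same sign, exactly one of the diagonal
  entries \<open>- b\<close> and \<open>a\<close> is negative. Dividing each axis by the root of the
  modulus of its entry gives the Minkowski form.\<close>

lemma lorentzian_static_metric:
  assumes "a (p $ 2) * b (p $ 2) > 0" "p $ 2 \<noteq> 0"
  shows "lorentzian (static_metric a b p)"
proof -
  obtain P where P: "transpose P ** static_metric a b p ** P = minkowski"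
  proof (cases "a (p $ 2) > 0")
    case True
    with assms have "b (p $ 2) > 0" by (simp add: zero_less_mult_iff)
    then show ?thesis
      using True assms
      by (intro that[of "\<chi> i j. if i = j then
          (vector [1 / sqrt (b (p $ 2)), 1 / sqrt (a (p $ 2)), 1 / p $ 2, 1 / p $ 2] :: real ^ 4) $ i
          else 0"])
        (simp add: vec_eq_iff forall_4 sum_4 matrix_matrix_mult_def minkowski_def transpose_def
          static_metric_nth power2_eq_square)
  next
    case False
    \<comment> \<open>here \<open>r\<close> is the timelike coordinate, so \<open>P\<close> swaps \<open>t\<close> and \<open>r\<close>\<close>
    with assms have "a (p $ 2) < 0" "b (p $ 2) < 0" by (auto simp: zero_less_mult_iff)
    then show ?thesis
      using assms
      by (intro that[of "\<chi> i j. if i = 1 \<and> j = 2 then 1 / sqrt (- b (p $ 2))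
          else if i = 2 \<and> j = 1 then 1 / sqrt (- a (p $ 2))
          else if i = j \<and> i \<noteq> 1 \<and> i \<noteq> 2 then 1 / p $ 2 else 0"])
        (simp add: vec_eq_iff forall_4 sum_4 matrix_matrix_mult_def minkowski_def transpose_def
          static_metric_nth power2_eq_square)
  qed
  \<comment> \<open>Invertibility of \<open>P\<close> follows from determinants: the congruence has
    determinant -1, so \<open>det P\<close> cannot vanish.\<close>
  moreover have "det minkowski = -1"
    unfolding minkowski_def by (subst det_diagonal) (simp, simp only: UNIV_4, simp)
  ultimately have "det P \<noteq> 0"
    using det_mul[of "transpose P ** static_metric a b p" P] by auto
  moreover have "transpose (static_metric a b p) = static_metric a b p"
    by (auto simp: static_metric_nth transpose_def vec_eq_iff)
  ultimately show ?thesis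
    unfolding lorentzian_def using P invertible_det_nz by blast
qed


subsection \<open>Curvature\<close>

text \<open>With \<open>f = 1 / a\<close> as the unknown, the vacuum part of the reduced equations
  is linear in \<open>f\<close>. Explicit \<open>f'\<close> and \<open>f''\<close> make all
  curvature computations algebraic. Only \<open>f r \<noteq> 0\<close> is demanded, so regions
  between horizons, where \<open>r\<close> is timelike, are covered.\<close>

locale radial_ansatz =
  fixes I :: "real set" and f f' f'' a b :: "real \<Rightarrow> real"
  assumes open_I: "open I"
    and pos: "r \<in> I \<Longrightarrow> 0 < r"
    and f_nz: "r \<in> I \<Longrightarrow> f r \<noteq> 0"
    and f_deriv: "r \<in> I \<Longrightarrow> (f has_real_derivative f' r) (at r)"
    and f'_deriv: "r \<in> I \<Longrightarrow> (f' has_real_derivative f'' r) (at r)"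
    and a_eq: "r \<in> I \<Longrightarrow> a r = 1 / f r"
    and b_eq: "r \<in> I \<Longrightarrow> b r = r^2 * f r"
begin

abbreviation g :: metric where "g \<equiv> static_metric a b"

lemma lorentzian_g: "p $ 2 \<in> I \<Longrightarrow> lorentzian (g p)"
  using pos[of "p $ 2"] f_nz[of "p $ 2"]
  by (intro lorentzian_static_metric) (auto simp: a_eq b_eq)

lemma inv_g:
  "p $ 2 \<in> I \<Longrightarrow> inv_metric g p $ i $ j = (if i = j then
     (if i = 1 then - 1 / ((p $ 2)^2 * f (p $ 2)) else if i = 2 then f (p $ 2) else 1 / (p $ 2)^2) else 0)"
  using pos[of "p $ 2"] f_nz[of "p $ 2"]
  by (subst inv_static_metric_nth) (auto simp: a_eq b_eq)

lemma partial_g: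
  assumes "p $ 2 \<in> I"
  shows "partial m (\<lambda>q. g q $ i $ j) p = (if m = 2 then (if i = j then
     (if i = 1 then - (2 * p $ 2 * f (p $ 2) + (p $ 2)^2 * f' (p $ 2)) else
      if i = 2 then - f' (p $ 2) / (f (p $ 2))^2 else 2 * p $ 2) else 0) else 0)"
  using assms f_nz
  by (intro partial_eqI[OF open_I, where h = "\<lambda>r. if i = j then
     (if i = 1 then - (r^2 * f r) else if i = 2 then 1 / f r else r^2) else 0"])
    (auto simp: static_metric_nth a_eq b_eq power2_eq_square intro!: derivative_eq_intros f_deriv)

text \<open>Christoffel symbols as functions of the radius alone, so that \<open>partial_eqI\<close>
  can differentiate them once more for the curvature.\<close>

definition Gam :: "4 \<Rightarrow> 4 \<Rightarrow> 4 \<Rightarrow> real \<Rightarrow> real" where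
  "Gam l m n r =
    (if l = 1 then (if m = 1 \<and> n = 2 \<or> m = 2 \<and> n = 1 then 1 / r + f' r / (2 * f r) else 0)
     else if l = 2 then
       (if m \<noteq> n then 0 else if m = 1 then r * (f r)^2 + r^2 * f r * f' r / 2
        else if m = 2 then - f' r / (2 * f r) else - r * f r)
     else if m = 2 \<and> n = l \<or> m = l \<and> n = 2 then 1 / r else 0)"

definition dGam :: "4 \<Rightarrow> 4 \<Rightarrow> 4 \<Rightarrow> real \<Rightarrow> real" where
  "dGam l m n r =
    (if l = 1 then (if m = 1 \<and> n = 2 \<or> m = 2 \<and> n = 1
       then - 1 / r^2 + (f'' r * f r - (f' r)^2) / (2 * (f r)^2) else 0)
     else if l = 2 then
       (if m \<noteq> n then 0 else if m = 1
        then (f r)^2 + 3 * r * f r * f' r + r^2 * ((f' r)^2 + f r * f'' r) / 2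
        else if m = 2 then - (f'' r * f r - (f' r)^2) / (2 * (f r)^2) else - f r - r * f' r)
     else if m = 2 \<and> n = l \<or> m = l \<and> n = 2 then - 1 / r^2 else 0)"

lemma Gam_deriv:
  assumes "r \<in> I"
  shows "(Gam l m n has_real_derivative dGam l m n r) (at r)"
proof -
  have nz: "r \<noteq> 0" "f r \<noteq> 0"
    using pos[OF assms] f_nz[OF assms] by auto
  have "((\<lambda>r. 1 / r + f' r / (2 * f r)) has_real_derivative
      - 1 / r^2 + (f'' r * f r - (f' r)^2) / (2 * (f r)^2)) (at r)"
    using nz
    by (auto intro!: derivative_eq_intros f_deriv[OF assms] f'_deriv[OF assms]
      simp: field_simps power2_eq_square)
  moreover have "((\<lambda>r. r * (f r)^2 + r^2 * f r * f' r / 2) has_real_derivative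
      (f r)^2 + 3 * r * f r * f' r + r^2 * ((f' r)^2 + f r * f'' r) / 2) (at r)"
    using nz
    by (auto intro!: derivative_eq_intros f_deriv[OF assms] f'_deriv[OF assms]
      simp: field_simps power2_eq_square)
  moreover have "((\<lambda>r. - f' r / (2 * f r)) has_real_derivative
      - (f'' r * f r - (f' r)^2) / (2 * (f r)^2)) (at r)"
    using nz
    by (auto intro!: derivative_eq_intros f_deriv[OF assms] f'_deriv[OF assms]
      simp: field_simps power2_eq_square)
  moreover have "((\<lambda>r. - r * f r) has_real_derivative - f r - r * f' r) (at r)"
    using nz
    by (auto intro!: derivative_eq_intros f_deriv[OF assms] f'_deriv[OF assms]
      simp: field_simps power2_eq_square)
  moreover have "((\<lambda>r. 1 / r) has_real_derivative - 1 / r^2) (at r)"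
    using nz
    by (auto intro!: derivative_eq_intros f_deriv[OF assms] f'_deriv[OF assms]
      simp: field_simps power2_eq_square)
  \<comment> \<open>The five derivatives above exhaust the distinct nonzero entries of the
    table.\<close>
  ultimately have "\<forall>l m n. (Gam l m n has_real_derivative dGam l m n r) (at r)"
    unfolding forall_4 Gam_def dGam_def by simp
  then show ?thesis by blast
qed

lemma christoffel_g:
  assumes "p $ 2 \<in> I"
  shows "christoffel g l m n p = Gam l m n (p $ 2)"
proof -
  have nz: "p $ 2 \<noteq> 0" "f (p $ 2) \<noteq> 0"
    using pos[OF assms] f_nz[OF assms] by auto
  have "\<forall>l m n. christoffel g l m n p = Gam l m n (p $ 2)"
    unfolding christoffel_def Gam_def partial_g[OF assms] inv_g[OF assms] forall_4 sum_4
    using nz by (simp add: field_simps power2_eq_square)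
  then show ?thesis by blast
qed

lemma partial_christoffel_g:
  assumes "p $ 2 \<in> I"
  shows "partial i (christoffel g l m n) p = (if i = 2 then dGam l m n (p $ 2) else 0)"
  using assms by (intro partial_eqI[OF open_I]) (auto simp: christoffel_g Gam_deriv)

lemma ricci_g:
  assumes "p $ 2 \<in> I"
  shows "ricci g m n p = (let r = p $ 2 in if m \<noteq> n then 0 else
     if m = 1 then f r * (2 * f r + 5/2 * r * f' r + r^2 * f'' r / 2) else
     if m = 2 then - f'' r / (2 * f r) - 5 * f' r / (2 * r * f r)
     else - 2 * f r - r * f' r)"
proof -
  define r where "r = p $ 2"
  have nz: "r \<noteq> 0" "f r \<noteq> 0"
    using pos[OF assms] f_nz[OF assms] by (auto simp: r_def)
  note sums = ricci_def riemann_def partial_christoffel_g[OF assms] christoffel_g[OF assms]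
    sum_4 r_def[symmetric] Gam_def dGam_def
  have "ricci g 1 1 p = f r * (2 * f r + 5/2 * r * f' r + r^2 * f'' r / 2)"
    unfolding sums using nz by simp (simp add: field_simps power2_eq_square)
  moreover have "ricci g 2 2 p = - f'' r / (2 * f r) - 5 * f' r / (2 * r * f r)"
    unfolding sums using nz by simp (simp add: field_simps power2_eq_square)
  moreover have "ricci g 3 3 p = - 2 * f r - r * f' r" "ricci g 4 4 p = - 2 * f r - r * f' r"
    unfolding sums using nz by (simp, simp add: field_simps power2_eq_square)+
  \<comment> \<open>Off the diagonal each term of the contraction vanishes by its indices
    alone.\<close>
  moreover have "\<forall>m n. m \<noteq> n \<longrightarrow> ricci g m n p = 0"
    unfolding sums forall_4 by simp
  ultimately show ?thesis
    using exhaust_4[of m] exhaust_4[of n] by (auto simp: Let_def r_def[symmetric])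
qed

lemma ricci_scalar_g:
  assumes "p $ 2 \<in> I"
  shows "ricci_scalar g p =
    (let r = p $ 2 in - 6 * f r / r^2 - 7 * f' r / r - f'' r)"
proof -
  have nz: "p $ 2 \<noteq> 0" "f (p $ 2) \<noteq> 0"
    using pos[OF assms] f_nz[OF assms] by auto
  show ?thesis
    unfolding ricci_scalar_def ricci_g[OF assms] inv_g[OF assms] sum_4 Let_def
    using nz by (simp add: field_simps power2_eq_square)
qed

end

subsection \<open>Field equations\<close>

text \<open>Reduces the equivalence of two equations to a single identity between differences; each
  field equation is simplified by exhibiting the nonzero factor \<open>c\<close>.\<close>

lemma eq_iff_of_diff_eq_mult:
  fixes l r c x y :: "'a::idom"
  assumes "l - r = c * (x - y)" "c \<noteq> 0"
  shows "l = r \<longleftrightarrow> x = y"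
  using assms by (metis eq_iff_diff_eq_0 mult_eq_0_iff)

lemma exp_dilaton:
  assumes "0 < k" "0 < p $ 2"
  shows "exp (\<gamma> * dilaton k p) = (k * p $ 2) powr (- 2 * \<gamma>)"
  using assms by (simp add: dilaton_def powr_def mult_ac)

text \<open>The electric profile \<alpha> is left arbitrary, so that both the charged potential and
  \<open>A = 0\<close> are instances.\<close>

locale charged_ansatz = radial_ansatz +
  fixes k \<gamma> :: real and \<alpha> \<alpha>' :: "real \<Rightarrow> real" and A :: "point \<Rightarrow> real ^ 4"
  assumes k_pos: "0 < k"
    and A_eq: "p $ 2 \<in> I \<Longrightarrow> A p = vector [\<alpha> (p $ 2), 0, 0, 0]"
    and \<alpha>_deriv: "r \<in> I \<Longrightarrow> (\<alpha> has_real_derivative \<alpha>' r) (at r)"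
begin

lemma field_strength_A:
  assumes "p $ 2 \<in> I"
  shows "field_strength A m n p = (if m = 2 \<and> n = 1 then \<alpha>' (p $ 2) else
    if m = 1 \<and> n = 2 then - \<alpha>' (p $ 2) else 0)"
proof -
  have "partial i (\<lambda>q. A q $ j) p = (if i = 2 then (if j = 1 then \<alpha>' (p $ 2) else 0) else 0)" for i j
    using assms exhaust_4[of j]
    by (intro partial_eqI[OF open_I, where h = "\<lambda>r. if j = 1 then \<alpha> r else 0"])
      (auto simp: A_eq \<alpha>_deriv)
  then show ?thesis
    by (auto simp: field_strength_def)
qed

lemma F_mixed_A:
  assumes "p $ 2 \<in> I"
  shows "F_mixed g A m n p = (if m = 2 \<and> n = 1 then - \<alpha>' (p $ 2) / ((p $ 2)^2 * f (p $ 2)) else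
    if m = 1 \<and> n = 2 then - f (p $ 2) * \<alpha>' (p $ 2) else 0)"
  using exhaust_4[of m] exhaust_4[of n]
  unfolding F_mixed_def field_strength_A[OF assms] inv_g[OF assms] sum_4 by auto

text \<open>\<open>f\<close> cancels because the \<open>tt\<close> and \<open>rr\<close> entries of
  the inverse metric multiply to \<open>- 1 / r^2\<close>, a consequence of
  \<open>a b = r^2\<close>.\<close>

lemma F_upper_A:
  assumes "p $ 2 \<in> I"
  shows "F_upper g A m n p = (if m = 2 \<and> n = 1 then - \<alpha>' (p $ 2) / (p $ 2)^2 else
    if m = 1 \<and> n = 2 then \<alpha>' (p $ 2) / (p $ 2)^2 else 0)"
  using exhaust_4[of m] exhaust_4[of n] f_nz[OF assms]
  unfolding F_upper_def F_mixed_A[OF assms] inv_g[OF assms] sum_4 by auto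

lemma F_sq_A:
  assumes "p $ 2 \<in> I"
  shows "F_sq g A p = - 2 * (\<alpha>' (p $ 2))^2 / (p $ 2)^2"
  unfolding F_sq_def F_upper_A[OF assms] field_strength_A[OF assms] sum_4
  by (simp add: power2_eq_square)

lemma partial_dilaton:
  assumes "p $ 2 \<in> I"
  shows "partial n (dilaton k) p = (if n = 2 then - 2 / p $ 2 else 0)"
  using k_pos assms pos
  by (intro partial_eqI[OF open_I, where h = "\<lambda>r. - 2 * ln (k * r)"])
    (auto simp: dilaton_def intro!: derivative_eq_intros)

lemma partial_partial_dilaton:
  assumes "p $ 2 \<in> I"
  shows "partial m (partial n (dilaton k)) p = (if m = 2 then (if n = 2 then 2 / (p $ 2)^2 else 0) else 0)"
  using assms pos[OF assms]
  by (intro partial_eqI[OF open_I assms, where h = "\<lambda>r. if n = 2 then - 2 / r else 0"])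
    (auto simp: partial_dilaton power2_eq_square intro!: derivative_eq_intros)

lemma grad_sq_dilaton:
  assumes "p $ 2 \<in> I"
  shows "grad_sq g (dilaton k) p = 4 * f (p $ 2) / (p $ 2)^2"
  unfolding grad_sq_def partial_dilaton[OF assms] inv_g[OF assms] sum_4
  by (simp add: power2_eq_square)

lemma box_dilaton:
  assumes "p $ 2 \<in> I"
  shows "box g (dilaton k) p = (let r = p $ 2 in - 2 * (2 * f r + r * f' r) / r^2)"
proof -
  have nz: "p $ 2 \<noteq> 0" "f (p $ 2) \<noteq> 0"
    using pos[OF assms] f_nz[OF assms] by auto
  show ?thesis
    unfolding box_def partial_dilaton[OF assms] partial_partial_dilaton[OF assms]
      inv_g[OF assms] christoffel_g[OF assms] sum_4 Gam_def Let_def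
    using nz by simp (simp add: field_simps power2_eq_square)
qed

text \<open>Here \<open>exp \<sigma> = 1 / (k r)^2\<close>, so the logarithmic profile removes
  \<open>k\<close> from the potential.\<close>

lemma potential_term:
  assumes "p $ 2 \<in> I"
  shows "4 * k^2 * exp (dilaton k p) = 4 / (p $ 2)^2"
  using exp_dilaton[of k p 1] k_pos pos[OF assms]
  by (simp add: powr_minus divide_simps mult_ac)

lemma scalar_eq_iff:
  assumes "p $ 2 \<in> I"
  shows "scalar_eq k \<gamma> g A (dilaton k) p \<longleftrightarrow> (let r = p $ 2 in
    2 * f r + r * f' r = 2 + \<gamma> * (exp (\<gamma> * dilaton k p) * (\<alpha>' r)^2) / 4)"
proof -
  define r where "r = p $ 2"
  define e where "e = exp (\<gamma> * dilaton k p) * (\<alpha>' r)^2"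
  have nz: "r \<noteq> 0"
    using pos[OF assms] by (auto simp: r_def)
  have "scalar_eq k \<gamma> g A (dilaton k) p \<longleftrightarrow>
      - 2 * (2 * f r + r * f' r) / r^2 = - 2 * (2 + \<gamma> * e / 4) / r^2"
    using potential_term[OF assms]
    unfolding scalar_eq_def box_dilaton[OF assms] F_sq_A[OF assms] Let_def
    by (simp add: r_def e_def add_divide_distrib diff_divide_distrib algebra_simps)
  also have "\<dots> \<longleftrightarrow> 2 * f r + r * f' r = 2 + \<gamma> * e / 4"
    by (rule eq_iff_of_diff_eq_mult[of _ _ "- 2 / r^2"])
      (use nz in \<open>auto simp: field_simps\<close>)
  finally show ?thesis
    by (simp add: Let_def r_def e_def)
qed

lemma einstein_eq_iff:
  assumes "p $ 2 \<in> I"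
  shows "einstein_eq k \<gamma> g A (dilaton k) p \<longleftrightarrow> (let r = p $ 2; e = exp (\<gamma> * dilaton k p) * (\<alpha>' r)^2 in
    2 * f r + r * f' r = 2 - e / 4 \<and> 4 * f r + 5 * r * f' r + r^2 * f'' r = 4 + e / 2)"
proof -
  define r where "r = p $ 2"
  define e where "e = exp (\<gamma> * dilaton k p) * (\<alpha>' r)^2"
  \<comment> \<open>\<open>R\<close> is the Ricci scalar, \<open>T\<close> is the bracket of half of
    \<open>grad_sq\<close> minus the potential, and \<open>W\<close> is the gauge coupling.\<close>
  define R where "R = - 6 * f r / r^2 - 7 * f' r / r - f'' r"
  define T where "T = 2 * f r / r^2 - 4 / r^2"
  define W where "W = exp (\<gamma> * dilaton k p)"
  have nz: "r \<noteq> 0" "f r \<noteq> 0"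
    using pos[OF assms] f_nz[OF assms] by (auto simp: r_def)
  have ab: "a r = 1 / f r" "b r = r^2 * f r"
    using a_eq[OF assms] b_eq[OF assms] by (auto simp: r_def)
  let ?X = "2 * f r + r * f' r"
  let ?L1 = "f r * (2 * f r + 5 * r * f' r / 2 + r^2 * f'' r / 2) + r^2 * f r * R / 2"
  let ?R1 = "r^2 * f r * T / 2 + W * (\<alpha>' r * (f r * \<alpha>' r) - f r * (\<alpha>' r)^2 / 2) / 2"
  let ?L2 = "- (f'' r / (2 * f r)) - 5 * f' r / (2 * r * f r) - R / (2 * f r)"
  let ?R2 = "2 / (r * r) - T / (2 * f r) +
    W * ((\<alpha>' r)^2 / (2 * f r * r^2) - \<alpha>' r * \<alpha>' r / (r^2 * f r)) / 2"
  let ?L3 = "- (2 * f r) - r * f' r - r^2 * R / 2"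
  let ?R3 = "W * (\<alpha>' r)^2 / 4 - r^2 * T / 2"
  \<comment> \<open>These are the \<open>tt\<close>, \<open>rr\<close> and \<open>xx\<close>
    components; \<open>yy\<close> repeats \<open>xx\<close>, and both sides vanish off the
    diagonal.\<close>
  have "einstein_eq k \<gamma> g A (dilaton k) p \<longleftrightarrow> ?L1 = ?R1 \<and> ?L2 = ?R2 \<and> ?L3 = ?R3"
    using potential_term[OF assms] nz
    unfolding einstein_eq_def F_sq_A[OF assms] ricci_g[OF assms] ricci_scalar_g[OF assms]
      grad_sq_dilaton[OF assms] field_strength_A[OF assms] F_mixed_A[OF assms]
      partial_dilaton[OF assms] static_metric_nth Let_def forall_4 sum_4
      r_def[symmetric] R_def[symmetric] W_def[symmetric]
    by (simp add: T_def ab)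
  \<comment> \<open>The \<open>tt\<close> and \<open>rr\<close> components are \<open>- f\<close>
    and \<open>1 / (r^2 f)\<close> times the same first-order equation.\<close>
  also have "?L1 = ?R1 \<longleftrightarrow> ?X = 2 - e / 4"
    by (rule eq_iff_of_diff_eq_mult[of _ _ "- f r"])
      (use nz in \<open>auto simp: e_def W_def[symmetric] r_def[symmetric] R_def T_def field_simps power2_eq_square\<close>)
  also have "?L2 = ?R2 \<longleftrightarrow> ?X = 2 - e / 4"
    by (rule eq_iff_of_diff_eq_mult[of _ _ "1 / (r^2 * f r)"])
      (use nz in \<open>auto simp: e_def W_def[symmetric] r_def[symmetric] R_def T_def field_simps power2_eq_square\<close>)
  also have "?L3 = ?R3 \<longleftrightarrow> 4 * f r + 5 * r * f' r + r^2 * f'' r = 4 + e / 2"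
    by (rule eq_iff_of_diff_eq_mult[of _ _ "1 / 2"])
      (use nz in \<open>auto simp: e_def W_def[symmetric] r_def[symmetric] R_def T_def field_simps power2_eq_square\<close>)
  finally show ?thesis
    by (simp add: Let_def r_def e_def)
qed

text \<open>Gauss's law: \<open>sqrt (- det g) = r^3\<close>, and the hypothesis makes
  \<open>r^3 exp (\<gamma> \<sigma>) F\<close> with upper indices \<open>t, r\<close> equal to the
  constant \<open>K\<close>, so the electric flux is conserved.\<close>

lemma maxwell_eqI:
  assumes "p $ 2 \<in> I"
    and K: "\<And>q. q $ 2 \<in> I \<Longrightarrow> exp (\<gamma> * dilaton k q) * \<alpha>' (q $ 2) = K / q $ 2"
  shows "maxwell_eq \<gamma> g A (dilaton k) p"
proof -
  define H where "H = (\<lambda>m n q. exp (\<gamma> * dilaton k q) * F_upper g A m n q)"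
  have H: "H m n q = (if m = 2 \<and> n = 1 then - K / (q $ 2)^3 else
    if m = 1 \<and> n = 2 then K / (q $ 2)^3 else 0)" if "q $ 2 \<in> I" for m n q
    using K[OF that] unfolding H_def F_upper_A[OF that]
    by (auto simp: field_simps power2_eq_square power3_eq_cube)
  have "partial i (H m n) p = (if i = 2 then (if m = 2 \<and> n = 1 then 3 * K / (p $ 2)^4 else
    if m = 1 \<and> n = 2 then - 3 * K / (p $ 2)^4 else 0) else 0)" for i m n
    using assms(1) pos[OF assms(1)]
    by (intro partial_eqI[OF open_I, where h = "\<lambda>r. if m = 2 \<and> n = 1 then - K / r^3 else
        if m = 1 \<and> n = 2 then K / r^3 else 0"])
      (auto simp: H field_simps power_numeral_reduce intro!: derivative_eq_intros)
  then have "\<forall>n. divergence g H n p = 0"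
    using pos[OF assms(1)] f_nz[OF assms(1)]
    unfolding divergence_def H[OF assms(1)] christoffel_g[OF assms(1)] forall_4 sum_4 Gam_def
    by (simp add: field_simps power_numeral_reduce)
  then show ?thesis
    unfolding maxwell_eq_def H_def .
qed

end

subsection \<open>Solutions\<close>

text \<open>Here \<open>c\<close> plays the role of \<open>r\<^sub>h\<^sup>2\<close> but may be negative.\<close>

definition blackening_c :: "real \<Rightarrow> real \<Rightarrow> real \<Rightarrow> real" where
  "blackening_c c Q r = 1 - c / r^2 + Q^2 / (4 * r^4)"

lemma blackening_c_deriv:
  assumes "r \<noteq> 0"
  shows "(blackening_c c Q has_real_derivative 2 * c / r^3 - Q^2 / r^5) (at r)"
    and "((\<lambda>r. 2 * c / r^3 - Q^2 / r^5) has_real_derivative - 6 * c / r^4 + 5 * Q^2 / r^6) (at r)"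
  unfolding blackening_c_def using assms
  by (auto intro!: derivative_eq_intros simp: field_simps power_numeral_reduce)

lemma radial_ansatz_blackening:
  assumes "open I" "I \<subseteq> {0<..}"
    and "\<And>r. r \<in> I \<Longrightarrow> blackening_c c Q r \<noteq> 0"
    and "\<And>r. r \<in> I \<Longrightarrow> a r = 1 / blackening_c c Q r"
    and "\<And>r. r \<in> I \<Longrightarrow> b r = r^2 * blackening_c c Q r"
  shows "radial_ansatz I (blackening_c c Q) (\<lambda>r. 2 * c / r^3 - Q^2 / r^5)
    (\<lambda>r. - 6 * c / r^4 + 5 * Q^2 / r^6) a b"
proof
  fix r assume "r \<in> I"
  then show "0 < r" using assms(2) by auto
  then show "(blackening_c c Q has_real_derivative 2 * c / r^3 - Q^2 / r^5) (at r)"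
    and "((\<lambda>r. 2 * c / r^3 - Q^2 / r^5) has_real_derivative - 6 * c / r^4 + 5 * Q^2 / r^6) (at r)"
    using blackening_c_deriv[of r] by auto
qed (use assms in auto)

lemma open_blackening_domain: "open {r. 0 < r \<and> blackening_c c Q r \<noteq> 0}"
proof -
  have "continuous_on {0<..} (blackening_c c Q)"
    by (intro continuous_at_imp_continuous_on ballI DERIV_isCont[OF blackening_c_deriv(1)]) auto
  then have "open ({0<..} \<inter> blackening_c c Q -` (- {0}))"
    by (intro continuous_open_preimage) auto
  also have "{0<..} \<inter> blackening_c c Q -` (- {0}) = {r. 0 < r \<and> blackening_c c Q r \<noteq> 0}"
    by auto
  finally show ?thesis .
qed

section \<open>The power-law gauge potential and its field equations\<close>

lemma charged_ansatz_gauge_potential: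
  assumes "radial_ansatz I f f' f'' a b" "0 < k" "\<gamma> \<noteq> 0"
  shows "charged_ansatz I f f' f'' a b k (\<lambda>r. - (C / (2 * \<gamma>)) * (k * r) powr (2 * \<gamma>))
    (\<lambda>r. - C * k * (k * r) powr (2 * \<gamma> - 1)) (gauge_potential k \<gamma> C)"
proof -
  interpret radial_ansatz I f f' f'' a b by fact
  show ?thesis
  proof
    fix r assume "r \<in> I"
    then have "0 < r" by (rule pos)
    then show "((\<lambda>r. - (C / (2 * \<gamma>)) * (k * r) powr (2 * \<gamma>)) has_real_derivative
        - C * k * (k * r) powr (2 * \<gamma> - 1)) (at r)"
      using assms by (auto intro!: derivative_eq_intros simp: powr_diff field_simps)
  qed (use assms in \<open>simp_all add: gauge_potential_def\<close>)
qed

text \<open>The coupling contributes \<open>(k r) powr (- 2 \<gamma>)\<close>. The first identity is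
  the premise of \<open>maxwell_eqI\<close> with flux constant \<open>- C\<close>; the second
  evaluates the source \<open>e\<close>.\<close>

lemma gauge_potential_coupling:
  assumes "0 < k" "0 < p $ 2"
  shows "exp (\<gamma> * dilaton k p) * (- C * k * (k * p $ 2) powr (2 * \<gamma> - 1)) = - C / p $ 2"
    and "exp (\<gamma> * dilaton k p) * (- C * k * (k * p $ 2) powr (2 * \<gamma> - 1))^2 =
      C^2 * k^2 * (k * p $ 2) powr (2 * \<gamma> - 2)"
proof -
  let ?x = "k * p $ 2"
  have x: "0 < ?x" using assms by simp
  have "exp (\<gamma> * dilaton k p) * (- C * k * ?x powr (2 * \<gamma> - 1)) =
      - C * k * (?x powr (- 2 * \<gamma>) * ?x powr (2 * \<gamma> - 1))"
    by (simp add: exp_dilaton[OF assms])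
  also have "?x powr (- 2 * \<gamma>) * ?x powr (2 * \<gamma> - 1) = 1 / ?x"
    using x by (simp add: powr_diff powr_minus field_simps)
  finally show "exp (\<gamma> * dilaton k p) * (- C * k * ?x powr (2 * \<gamma> - 1)) = - C / p $ 2"
    using assms by simp
  have "exp (\<gamma> * dilaton k p) * (- C * k * ?x powr (2 * \<gamma> - 1))^2 =
      C^2 * k^2 * (?x powr (- 2 * \<gamma>) * (?x powr (2 * \<gamma> - 1) * ?x powr (2 * \<gamma> - 1)))"
    by (simp add: exp_dilaton[OF assms] power_mult_distrib power2_eq_square)
  also have "?x powr (- 2 * \<gamma>) * (?x powr (2 * \<gamma> - 1) * ?x powr (2 * \<gamma> - 1)) = ?x powr (2 * \<gamma> - 2)"
    by (simp flip: powr_add)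
  finally show "exp (\<gamma> * dilaton k p) * (- C * k * ?x powr (2 * \<gamma> - 1))^2 =
      C^2 * k^2 * ?x powr (2 * \<gamma> - 2)" .
qed

lemma maxwell_gauge_potential:
  assumes "radial_ansatz I f f' f'' a b" "0 < k" "\<gamma> \<noteq> 0" "p $ 2 \<in> I"
  shows "maxwell_eq \<gamma> (static_metric a b) (gauge_potential k \<gamma> C) (dilaton k) p"
proof -
  interpret charged_ansatz I f f' f'' a b k \<gamma> "\<lambda>r. - (C / (2 * \<gamma>)) * (k * r) powr (2 * \<gamma>)"
    "\<lambda>r. - C * k * (k * r) powr (2 * \<gamma> - 1)" "gauge_potential k \<gamma> C"
    by (intro charged_ansatz_gauge_potential assms)
  show ?thesis
    using assms pos by (intro maxwell_eqI[where K = "- C"] gauge_potential_coupling) auto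
qed

text \<open>A single point suffices to fix \<gamma>: subtracting the scalar equation from the
  \<open>tt\<close> equation leaves \<open>(\<gamma> + 1) e = 0\<close>, and \<open>e > 0\<close>
  since \<open>C \<noteq> 0\<close>.\<close>

lemma field_eqs_gauge_potential_iff:
  assumes "radial_ansatz I f f' f'' a b" "0 < k" "\<gamma> \<noteq> 0" "p $ 2 \<in> I" "C \<noteq> 0"
    and Q: "Q = C / (sqrt 2 * k)"
  shows "einstein_eq k \<gamma> (static_metric a b) (gauge_potential k \<gamma> C) (dilaton k) p \<and>
      scalar_eq k \<gamma> (static_metric a b) (gauge_potential k \<gamma> C) (dilaton k) p \<longleftrightarrow>
    \<gamma> = - 1 \<and> (let r = p $ 2 in 2 * f r + r * f' r = 2 - Q^2 / (2 * r^4) \<and>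
      4 * f r + 5 * r * f' r + r^2 * f'' r = 4 + Q^2 / r^4)"
proof -
  interpret charged_ansatz I f f' f'' a b k \<gamma> "\<lambda>r. - (C / (2 * \<gamma>)) * (k * r) powr (2 * \<gamma>)"
    "\<lambda>r. - C * k * (k * r) powr (2 * \<gamma> - 1)" "gauge_potential k \<gamma> C"
    by (intro charged_ansatz_gauge_potential assms)
  define r where "r = p $ 2"
  have "0 < r" using pos assms by (auto simp: r_def)
  define e where "e = C^2 * k^2 * (k * r) powr (2 * \<gamma> - 2)"
  have "0 < e" using \<open>0 < r\<close> assms by (simp add: e_def)
  have e: "exp (\<gamma> * dilaton k p) * (- C * k * (k * r) powr (2 * \<gamma> - 1))^2 = e"
    using gauge_potential_coupling(2)[of k p] \<open>0 < r\<close> assms by (simp add: e_def r_def)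
  \<comment> \<open>At this \<gamma> the source is \<open>C^2 / (k^2 r^4)\<close>, and the
    normalisation of \<open>Q\<close> means \<open>C^2 = 2 k^2 Q^2\<close>.\<close>
  have eQ: "e = 2 * Q^2 / r^4" if "\<gamma> = - 1"
  proof -
    have "(k * r) powr (- 4) = 1 / (k * r)^4"
      using \<open>0 < r\<close> \<open>0 < k\<close> by (simp add: powr_minus divide_simps)
    then show ?thesis
      using that \<open>0 < r\<close> \<open>0 < k\<close>
      by (simp add: e_def Q power_divide power_mult_distrib field_simps power_numeral_reduce)
  qed
  have "einstein_eq k \<gamma> g (gauge_potential k \<gamma> C) (dilaton k) p \<and>
      scalar_eq k \<gamma> g (gauge_potential k \<gamma> C) (dilaton k) p \<longleftrightarrow>
    2 * f r + r * f' r = 2 - e / 4 \<and> 4 * f r + 5 * r * f' r + r^2 * f'' r = 4 + e / 2 \<and>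
    2 * f r + r * f' r = 2 + \<gamma> * e / 4"
    using e unfolding einstein_eq_iff[OF assms(4)] scalar_eq_iff[OF assms(4)] Let_def r_def[symmetric]
    by simp
  also have "\<dots> \<longleftrightarrow> \<gamma> = - 1 \<and> 2 * f r + r * f' r = 2 - e / 4 \<and>
      4 * f r + 5 * r * f' r + r^2 * f'' r = 4 + e / 2"
  proof -
    have "2 - e / 4 = 2 + \<gamma> * e / 4 \<longleftrightarrow> \<gamma> = - 1"
      by (rule eq_iff_of_diff_eq_mult[of _ _ "- e / 4"])
        (use \<open>0 < e\<close> in \<open>auto simp: field_simps\<close>)
    then show ?thesis by auto
  qed
  also have "\<dots> \<longleftrightarrow> \<gamma> = - 1 \<and> 2 * f r + r * f' r = 2 - Q^2 / (2 * r^4) \<and>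
      4 * f r + 5 * r * f' r + r^2 * f'' r = 4 + Q^2 / r^4"
    using eQ by auto
  finally show ?thesis
    by (simp add: Let_def r_def)
qed

lemma blackening_c_ode:
  fixes c Q r :: real
  assumes "r \<noteq> 0"
  defines "f \<equiv> blackening_c c Q r" and "f' \<equiv> 2 * c / r^3 - Q^2 / r^5"
    and "f'' \<equiv> - 6 * c / r^4 + 5 * Q^2 / r^6"
  shows "2 * f + r * f' = 2 - Q^2 / (2 * r^4)"
    and "4 * f + 5 * r * f' + r^2 * f'' = 4 + Q^2 / r^4"
  using assms(1) by (auto simp: f_def f'_def f''_def blackening_c_def field_simps power_numeral_reduce)

text \<open>The integrating factor \<open>r\<close> turns the left side of the equation into the
  derivative of \<open>r^2 f\<close>. Connectedness of \<open>I\<close> yields a single integration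
  constant.\<close>

lemma blackening_c_unique:
  assumes "open I" "connected I" "I \<subseteq> {0<..}"
    and f: "\<And>r. r \<in> I \<Longrightarrow> (f has_real_derivative f' r) (at r)"
    and ode: "\<And>r. r \<in> I \<Longrightarrow> 2 * f r + r * f' r = 2 - Q^2 / (2 * r^4)"
  obtains c where "\<And>r. r \<in> I \<Longrightarrow> f r = blackening_c c Q r"
proof -
  define h where "h = (\<lambda>r. r^2 + Q^2 / (4 * r^2) - r^2 * f r)"
  have h: "(h has_real_derivative 0) (at r)" if "r \<in> I" for r
  proof -
    have "0 < r" using that assms by auto
    have "(h has_real_derivative 2 * r - Q^2 / (2 * r^3) - r * (2 * f r + r * f' r)) (at r)"
      unfolding h_def using \<open>0 < r\<close>
      by (auto intro!: derivative_eq_intros f[OF that] simp: field_simps power_numeral_reduce)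
    also have "2 * r - Q^2 / (2 * r^3) - r * (2 * f r + r * f' r) = 0"
      using \<open>0 < r\<close> unfolding ode[OF that] by (simp add: field_simps power_numeral_reduce)
    finally show ?thesis .
  qed
  obtain c where c: "\<And>r. r \<in> I \<Longrightarrow> h r = c"
  proof (rule DERIV_zero_connected_constant)
    show "continuous_on I h"
      using h by (auto intro!: continuous_at_imp_continuous_on DERIV_isCont)
  qed (use assms h in auto)
  show ?thesis
  proof (rule that)
    fix r assume "r \<in> I"
    then have "0 < r" using assms by auto
    then have "h r = c \<longleftrightarrow> f r = blackening_c c Q r"
      by (intro eq_iff_of_diff_eq_mult[of _ _ "- (r^2)"])
        (auto simp: h_def blackening_c_def field_simps power_numeral_reduce)
    then show "f r = blackening_c c Q r"
      using c[OF \<open>r \<in> I\<close>] by simp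
  qed
qed

lemma is_solution_blackening_charged:
  assumes "radial_ansatz I (blackening_c c Q) (\<lambda>r. 2 * c / r^3 - Q^2 / r^5)
    (\<lambda>r. - 6 * c / r^4 + 5 * Q^2 / r^6) a b" "0 < k" "C \<noteq> 0" "Q = C / (sqrt 2 * k)"
  shows "is_solution k (- 1) (radial_domain I) (static_metric a b) (gauge_potential k (- 1) C) (dilaton k)"
proof -
  interpret radial_ansatz I "blackening_c c Q" "\<lambda>r. 2 * c / r^3 - Q^2 / r^5"
    "\<lambda>r. - 6 * c / r^4 + 5 * Q^2 / r^6" a b by fact
  show ?thesis
    unfolding is_solution_def radial_domain_def
  proof (intro ballI)
    fix p :: point assume "p \<in> {p. p $ 2 \<in> I}"
    then have p: "p $ 2 \<in> I" by simp
    have "p $ 2 \<noteq> 0" using pos[OF p] by simp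
    then show "lorentzian (g p) \<and>
        einstein_eq k (- 1) g (gauge_potential k (- 1) C) (dilaton k) p \<and>
        maxwell_eq (- 1) g (gauge_potential k (- 1) C) (dilaton k) p \<and>
        scalar_eq k (- 1) g (gauge_potential k (- 1) C) (dilaton k) p"
      using lorentzian_g[OF p] maxwell_gauge_potential[OF assms(1,2) _ p, of "- 1" C]
        field_eqs_gauge_potential_iff[OF assms(1,2) _ p assms(3,4), of "- 1"]
        blackening_c_ode[of "p $ 2" c Q]
      by (simp add: Let_def)
  qed
qed

text \<open>For \<open>A = 0\<close> the source vanishes, so the scalar equation coincides with the
  \<open>tt\<close> equation and leaves \<gamma> free. This case is separate because the charged
  equivalence assumes \<open>C \<noteq> 0\<close>.\<close>

lemma is_solution_blackening_uncharged:
  assumes "radial_ansatz I (blackening_c c 0) (\<lambda>r. 2 * c / r^3 - 0^2 / r^5)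
    (\<lambda>r. - 6 * c / r^4 + 5 * 0^2 / r^6) a b" "0 < k"
  shows "is_solution k \<gamma> (radial_domain I) (static_metric a b) (\<lambda>_. 0) (dilaton k)"
proof -
  interpret charged_ansatz I "blackening_c c 0" "\<lambda>r. 2 * c / r^3 - 0^2 / r^5"
    "\<lambda>r. - 6 * c / r^4 + 5 * 0^2 / r^6" a b k \<gamma> "\<lambda>_. 0" "\<lambda>_. 0" "\<lambda>_. 0"
    using assms unfolding charged_ansatz_def charged_ansatz_axioms_def
    by (auto simp: vec_eq_iff forall_4)
  show ?thesis
    unfolding is_solution_def radial_domain_def
  proof (intro ballI)
    fix p :: point assume "p \<in> {p. p $ 2 \<in> I}"
    then have p: "p $ 2 \<in> I" by simp
    have "p $ 2 \<noteq> 0" using pos[OF p] by simp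
    then show "lorentzian (g p) \<and> einstein_eq k \<gamma> g (\<lambda>_. 0) (dilaton k) p \<and>
        maxwell_eq \<gamma> g (\<lambda>_. 0) (dilaton k) p \<and> scalar_eq k \<gamma> g (\<lambda>_. 0) (dilaton k) p"
      using lorentzian_g[OF p] maxwell_eqI[OF p, of 0] blackening_c_ode[of "p $ 2" c 0]
      by (simp add: einstein_eq_iff[OF p] scalar_eq_iff[OF p] Let_def)
  qed
qed

lemma line_element_static_metric:
  "line_element (static_metric a b) (vector [t, r, x, y]) (vector [dt, dr, dx, dy]) =
     - b r * dt^2 + a r * dr^2 + r^2 * (dx^2 + dy^2)"
  unfolding line_element_def sum_4 static_metric_nth
  by (simp add: power2_eq_square algebra_simps)

subsection \<open>Horizons and surface gravity\<close>

lemma (in radial_ansatz) grad_sq_radial: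
  assumes "p $ 2 \<in> I" "\<And>q. q $ 2 \<in> I \<Longrightarrow> s q = h (q $ 2)"
    and "(h has_real_derivative D) (at (p $ 2))"
  shows "grad_sq g s p = f (p $ 2) * D^2"
proof -
  have "partial m s p = (if m = 2 then D else 0)" for m
    using assms by (intro partial_eqI[OF open_I])
  then show ?thesis
    unfolding grad_sq_def inv_g[OF assms(1)] sum_4 by (simp add: power2_eq_square)
qed

section \<open>The blackening factor and its roots\<close>

lemma blackening_eq: "blackening rh Q = blackening_c (rh^2) Q"
  by (simp add: blackening_def blackening_c_def fun_eq_iff)

lemma tendsto_blackening_c:
  "r \<noteq> 0 \<Longrightarrow> (blackening_c c Q \<longlongrightarrow> blackening_c c Q r) (at r within S)"
  using DERIV_isCont[OF blackening_c_deriv(1)] by (auto simp: isCont_def intro: tendsto_within_subset)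

lemma radial_ansatz_bh_metric:
  "radial_ansatz {r. 0 < r \<and> blackening rh Q r \<noteq> 0} (blackening rh Q) (\<lambda>r. 2 * rh^2 / r^3 - Q^2 / r^5)
    (\<lambda>r. - 6 * rh^2 / r^4 + 5 * Q^2 / r^6) (\<lambda>r. 1 / blackening rh Q r) (\<lambda>r. r^2 * blackening rh Q r)"
  unfolding blackening_eq
  by (intro radial_ansatz_blackening open_blackening_domain) auto

text \<open>Vieta's relations: the squares of the two radii are the roots of
  \<open>z^2 - rh^2 z + Q^2 / 4\<close>, real because \<open>Q^2 \<le> rh^4\<close>.\<close>

lemma r_plus_minus_squares:
  assumes "0 < rh" "Q^2 \<le> rh^4"
  shows "(r_plus rh Q)^2 + (r_minus rh Q)^2 = rh^2"
    and "(r_plus rh Q)^2 * (r_minus rh Q)^2 = Q^2 / 4"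
    and "(r_plus rh Q)^2 - (r_minus rh Q)^2 = rh^2 * sqrt (1 - Q^2 / rh^4)"
    and "0 < r_plus rh Q" "0 \<le> r_minus rh Q"
proof -
  define s where "s = sqrt (1 - Q^2 / rh^4)"
  have q: "0 \<le> Q^2 / rh^4" "Q^2 / rh^4 \<le> 1"
    using assms by (auto simp: divide_simps)
  have s: "0 \<le> s" "s \<le> 1" "s^2 = 1 - Q^2 / rh^4"
    using q by (auto simp: s_def)
  have rp: "(r_plus rh Q)^2 = rh^2 / 2 * (1 + s)"
    using s unfolding r_plus_def s_def[symmetric] by (simp add: power_mult_distrib power_divide)
  have rm: "(r_minus rh Q)^2 = rh^2 / 2 * (1 - s)"
    using s unfolding r_minus_def s_def[symmetric] by (simp add: power_mult_distrib power_divide)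
  show "(r_plus rh Q)^2 + (r_minus rh Q)^2 = rh^2"
    and "(r_plus rh Q)^2 - (r_minus rh Q)^2 = rh^2 * sqrt (1 - Q^2 / rh^4)"
    unfolding rp rm s_def[symmetric] by (simp_all add: field_simps)
  have "(r_plus rh Q)^2 * (r_minus rh Q)^2 = rh^4 / 4 * (1 - s^2)"
    unfolding rp rm by (simp add: field_simps power_numeral_reduce)
  then show "(r_plus rh Q)^2 * (r_minus rh Q)^2 = Q^2 / 4"
    using assms(1) by (simp add: s(3))
  show "0 < r_plus rh Q"
    using assms(1) s unfolding r_plus_def s_def[symmetric]
    by (intro mult_pos_pos) auto
  show "0 \<le> r_minus rh Q"
    using assms(1) s unfolding r_minus_def s_def[symmetric]
    by (intro mult_nonneg_nonneg) auto
qed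

lemma r_minus_pos:
  assumes "0 < rh" "Q^2 \<le> rh^4" "Q \<noteq> 0"
  shows "0 < r_minus rh Q"
proof -
  have "r_minus rh Q \<noteq> 0"
    using r_plus_minus_squares(2)[OF assms(1,2)] assms(3) by auto
  then show ?thesis
    using r_plus_minus_squares(5)[OF assms(1,2)] by simp
qed

lemma blackening_eq_0_iff:
  assumes "0 < rh" "Q^2 \<le> rh^4" "0 < r"
  shows "blackening rh Q r = 0 \<longleftrightarrow> r = r_plus rh Q \<or> r = r_minus rh Q"
proof -
  let ?p = "r_plus rh Q" and ?m = "r_minus rh Q"
  note sq = r_plus_minus_squares[OF assms(1,2)]
  have "r^4 * blackening rh Q r = r^4 - rh^2 * r^2 + Q^2 / 4"
    using assms(3) by (simp add: blackening_def field_simps power_numeral_reduce)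
  also have "\<dots> = (r^2 - ?p^2) * (r^2 - ?m^2)"
    unfolding sq(1,2)[symmetric] by (simp add: field_simps power_numeral_reduce)
  finally have "blackening rh Q r = 0 \<longleftrightarrow> r^2 = ?p^2 \<or> r^2 = ?m^2"
    using assms(3) by (metis eq_iff_diff_eq_0 mult_eq_0_iff power_eq_0_iff less_irrefl)
  then show ?thesis
    using assms(3) sq(4,5) by (auto simp: power2_eq_iff_nonneg)
qed

text \<open>There are at most two zeros, so limits towards a horizon only involve radii where the
  closed form of the inverse metric is valid.\<close>

lemma eventually_blackening_neq_0:
  assumes "0 < rh" "Q^2 \<le> rh^4" "0 < r0"
  shows "\<forall>\<^sub>F r in at r0 within {0<..}. 0 < r \<and> blackening rh Q r \<noteq> 0"
proof -
  have "\<forall>\<^sub>F r in at r0 within {0<..}. r \<noteq> r_plus rh Q"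
    and "\<forall>\<^sub>F r in at r0 within {0<..}. r \<noteq> r_minus rh Q"
    by (intro eventually_neq_at_within)+
  moreover have "\<forall>\<^sub>F r in at r0 within {0<..}. r \<in> {0::real<..}"
    by (simp add: eventually_at_filter)
  ultimately show ?thesis
    by eventually_elim (use blackening_eq_0_iff[OF assms(1,2)] in auto)
qed

lemma islimpt_greaterThan_0: "0 < r0 \<Longrightarrow> r0 islimpt {0::real<..}"
  by (intro open_imp_islimpt) auto

text \<open>With \<open>f\<close> the blackening factor, the \<open>tt\<close> entry is
  \<open>- r^2 f\<close> and the squared gradient of \<open>r\<close> is \<open>f\<close> wherever
  \<open>f \<noteq> 0\<close>. Hence both limits vanish exactly when the continuous \<open>f\<close>
  vanishes at \<open>r0\<close>.\<close>

lemma horizon_at_bh_metric_iff: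
  assumes "0 < rh" "Q^2 \<le> rh^4"
  shows "horizon_at {0<..} (bh_metric rh Q) r0 \<longleftrightarrow> 0 < r0 \<and> blackening rh Q r0 = 0"
proof (cases "0 < r0")
  case True
  interpret radial_ansatz "{r. 0 < r \<and> blackening rh Q r \<noteq> 0}" "blackening rh Q"
    "\<lambda>r. 2 * rh^2 / r^3 - Q^2 / r^5" "\<lambda>r. - 6 * rh^2 / r^4 + 5 * Q^2 / r^6"
    "\<lambda>r. 1 / blackening rh Q r" "\<lambda>r. r^2 * blackening rh Q r"
    by (rule radial_ansatz_bh_metric)
  have nt: "at r0 within {0<..} \<noteq> bot"
    using islimpt_greaterThan_0[OF True] trivial_limit_within by blast
  have bl: "(blackening rh Q \<longlongrightarrow> blackening rh Q r0) (at r0 within {0<..})"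
    unfolding blackening_eq using True by (intro tendsto_blackening_c) auto
  have g11: "((\<lambda>r. bh_metric rh Q (vector [t, r, x, y]) $ 1 $ 1) \<longlongrightarrow> - (r0^2 * blackening rh Q r0))
      (at r0 within {0<..})" for t x y
    unfolding bh_metric_def static_metric_nth by (auto intro!: tendsto_intros bl)
  have "grad_sq (bh_metric rh Q) (\<lambda>p. p $ 2) (vector [t, r, x, y]) = blackening rh Q r"
    if "0 < r \<and> blackening rh Q r \<noteq> 0" for t r x y
    unfolding bh_metric_def using that
    by (subst grad_sq_radial[where h = "\<lambda>r. r" and D = 1]) auto
  then have grr: "((\<lambda>r. grad_sq (bh_metric rh Q) (\<lambda>p. p $ 2) (vector [t, r, x, y])) \<longlongrightarrow> blackening rh Q r0)
      (at r0 within {0<..})" for t x y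
    using eventually_blackening_neq_0[OF assms True]
    by (intro Lim_transform_eventually[OF bl]) (auto elim: eventually_mono)
  show ?thesis
  proof
    assume "horizon_at {0<..} (bh_metric rh Q) r0"
    then have "- (r0^2 * blackening rh Q r0) = 0"
      unfolding horizon_at_def by (intro tendsto_unique[OF nt g11[of 0 0 0]]) blast
    then show "0 < r0 \<and> blackening rh Q r0 = 0" using True by auto
  next
    assume "0 < r0 \<and> blackening rh Q r0 = 0"
    then show "horizon_at {0<..} (bh_metric rh Q) r0"
      using g11 grr islimpt_greaterThan_0[OF True] unfolding horizon_at_def by auto
  qed
qed (simp add: horizon_at_def)

text \<open>In the quotient \<open>f\<close> cancels, leaving the square of the derivative of
  \<open>r^2 f\<close> over \<open>4 r^2\<close>, which has a limit. At a zero of \<open>f\<close>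
  the resulting value is the modulus of \<open>r0 f'(r0) / 2\<close>.\<close>

lemma has_surface_gravity_bh_metric:
  assumes "0 < rh" "Q^2 \<le> rh^4" "0 < r0" "blackening rh Q r0 = 0"
  shows "has_surface_gravity {0<..} (bh_metric rh Q) r0 \<bar>rh^2 / r0^2 - Q^2 / (2 * r0^4)\<bar>"
proof -
  interpret radial_ansatz "{r. 0 < r \<and> blackening rh Q r \<noteq> 0}" "blackening rh Q"
    "\<lambda>r. 2 * rh^2 / r^3 - Q^2 / r^5" "\<lambda>r. - 6 * rh^2 / r^4 + 5 * Q^2 / r^6"
    "\<lambda>r. 1 / blackening rh Q r" "\<lambda>r. r^2 * blackening rh Q r"
    by (rule radial_ansatz_bh_metric)
  have g11: "bh_metric rh Q p $ 1 $ 1 = - ((p $ 2)^2 * blackening rh Q (p $ 2))" for p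
    by (simp add: bh_metric_def static_metric_nth)
  have eq: "grad_sq (bh_metric rh Q) (\<lambda>p. bh_metric rh Q p $ 1 $ 1) (vector [t, r, x, y])
      / (- 4 * bh_metric rh Q (vector [t, r, x, y]) $ 1 $ 1) = (r - Q^2 / (4 * r^3))^2 / r^2"
    if r: "0 < r \<and> blackening rh Q r \<noteq> 0" for t r x y
  proof -
    define X where "X = r - Q^2 / (4 * r^3)"
    have "((\<lambda>r. - (r^2 * blackening rh Q r)) has_real_derivative
        - (2 * r * blackening rh Q r + r^2 * (2 * rh^2 / r^3 - Q^2 / r^5))) (at r)"
      using f_deriv[of r] r by (auto intro!: derivative_eq_intros)
    also have "2 * r * blackening rh Q r + r^2 * (2 * rh^2 / r^3 - Q^2 / r^5) = 2 * X"
      using r by (simp add: X_def blackening_def field_simps power_numeral_reduce)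
    finally have "grad_sq (bh_metric rh Q) (\<lambda>p. bh_metric rh Q p $ 1 $ 1) (vector [t, r, x, y])
        = blackening rh Q r * (- (2 * X))^2"
      using r unfolding g11 unfolding bh_metric_def
      by (subst grad_sq_radial[where h = "\<lambda>r. - (r^2 * blackening rh Q r)"]) auto
    then show ?thesis
      using r unfolding g11 X_def[symmetric] by (simp add: power_mult_distrib)
  qed
  have "((\<lambda>r. (r - Q^2 / (4 * r^3))^2 / r^2) \<longlongrightarrow> (r0 - Q^2 / (4 * r0^3))^2 / r0^2) (at r0 within {0<..})"
    using assms(3) by (auto intro!: tendsto_eq_intros)
  also have "(r0 - Q^2 / (4 * r0^3))^2 / r0^2 = \<bar>rh^2 / r0^2 - Q^2 / (2 * r0^4)\<bar>^2"
  proof -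
    \<comment> \<open>Splitting off the blackening factor brings in the horizon condition, under
      which that summand is zero.\<close>
    have "(r0 - Q^2 / (4 * r0^3)) / r0 = blackening rh Q r0 + (rh^2 / r0^2 - Q^2 / (2 * r0^4))"
      using assms(3) by (simp add: blackening_def field_simps power_numeral_reduce)
    then have "(r0 - Q^2 / (4 * r0^3)) / r0 = rh^2 / r0^2 - Q^2 / (2 * r0^4)"
      by (simp only: assms(4) add_0)
    then show ?thesis by (metis power_divide power2_abs)
  qed
  finally have lim: "((\<lambda>r. (r - Q^2 / (4 * r^3))^2 / r^2) \<longlongrightarrow> \<bar>rh^2 / r0^2 - Q^2 / (2 * r0^4)\<bar>^2)
    (at r0 within {0<..})" .
  show ?thesis
    unfolding has_surface_gravity_def
    by (intro conjI allI Lim_transform_eventually[OF lim]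
        eventually_mono[OF eventually_blackening_neq_0[OF assms(1-3)] eq[symmetric]]) auto
qed

section \<open>Derivation of the charged black hole from the ansatz, its horizons and its extremal
  limit\<close>

theorem mainTheorem4:
  fixes k \<gamma> C Q :: real and I :: "real set" and a b :: "real \<Rightarrow> real"
  assumes "0 < k" and "\<gamma> \<noteq> 0" and "C \<noteq> 0"
    and Q_def: "Q = C / (sqrt 2 * k)"
    and "open I" and "connected I" and "I \<noteq> {}" and "I \<subseteq> {0<..}"
    and "\<forall>r\<in>I. a differentiable (at r)"
    and "\<forall>r\<in>I. deriv a differentiable (at r)"
    and "\<forall>r\<in>I. a r \<noteq> 0"
    and "\<forall>r\<in>I. b r = r^2 / a r"
  shows
    \<comment> \<open>the gauge potential solves the Maxwell equation on the ansatz\<close>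
    "(\<forall>p\<in>radial_domain I.
       maxwell_eq \<gamma> (static_metric a b) (gauge_potential k \<gamma> C) (dilaton k) p) \<and>
    \<comment> \<open>the remaining equations determine \<open>\<gamma>\<close>, \<open>a\<close> and \<open>b\<close>; the integration constant is \<open>rh\<^sup>2\<close>,
        a real number of either sign, so the constant \<open>rh\<close> is real or purely imaginary\<close>
    ((\<forall>p\<in>radial_domain I.
        einstein_eq k \<gamma> (static_metric a b) (gauge_potential k \<gamma> C) (dilaton k) p \<and>
        scalar_eq k \<gamma> (static_metric a b) (gauge_potential k \<gamma> C) (dilaton k) p)
     \<longleftrightarrow> \<gamma> = - 1 \<and>
        (\<exists>rh :: complex. \<forall>r\<in>I.
           complex_of_real (a r)
             = 1 / (1 - rh^2 / of_real (r^2) + of_real (Q^2 / (4 * r^4))) \<and>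
           complex_of_real (b r)
             = of_real (r^2) * (1 - rh^2 / of_real (r^2) + of_real (Q^2 / (4 * r^4))))) \<and>
    \<comment> \<open>if the solution reaches a horizon, then \<open>rh\<close> is a positive real\<close>
    (is_solution k \<gamma> (radial_domain I) (static_metric a b) (gauge_potential k \<gamma> C) (dilaton k) \<longrightarrow>
     (\<exists>r0. horizon_at I (static_metric a b) r0) \<longrightarrow>
     (\<exists>rh>0. \<forall>r\<in>I. a r = 1 / (1 - rh^2 / r^2 + Q^2 / (4 * r^4)) \<and>
                    b r = r^2 * (1 - rh^2 / r^2 + Q^2 / (4 * r^4)))) \<and>
    \<comment> \<open>the charged linear dilaton black hole and its line element\<close>
    (\<forall>rh. is_solution k (- 1) (radial_domain {r. 0 < r \<and> blackening rh Q r \<noteq> 0})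
            (bh_metric rh Q) (gauge_potential k (- 1) C) (dilaton k)) \<and>
    (\<forall>rh t r x y dt dr dx dy.
       0 < r \<longrightarrow> 1 - rh^2 / r^2 + Q^2 / (4 * r^4) \<noteq> 0 \<longrightarrow>
       line_element (bh_metric rh Q) (vector [t, r, x, y]) (vector [dt, dr, dx, dy]) =
         - (r^2 * (1 - rh^2 / r^2 + Q^2 / (4 * r^4))) * dt^2
         + dr^2 / (1 - rh^2 / r^2 + Q^2 / (4 * r^4)) + r^2 * (dx^2 + dy^2)) \<and>
    \<comment> \<open>the uncharged limit\<close>
    (\<forall>rh t r x y dt dr dx dy.
       0 < r \<longrightarrow> 1 - rh^2 / r^2 \<noteq> 0 \<longrightarrow>
       ((\<lambda>q. line_element (bh_metric rh q) (vector [t, r, x, y]) (vector [dt, dr, dx, dy]))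
          \<longlongrightarrow> - (r^2 * (1 - rh^2 / r^2)) * dt^2 + dr^2 / (1 - rh^2 / r^2)
               + r^2 * (dx^2 + dy^2)) (at 0)) \<and>
    (\<forall>rh. is_solution k (- 1) (radial_domain {r. 0 < r \<and> 1 - rh^2 / r^2 \<noteq> 0})
            (static_metric (\<lambda>r. 1 / (1 - rh^2 / r^2)) (\<lambda>r. r^2 * (1 - rh^2 / r^2)))
            (\<lambda>_. 0) (dilaton k)) \<and>
    \<comment> \<open>outer and inner horizons\<close>
    (\<forall>rh r0. 0 < rh \<longrightarrow> Q^2 \<le> rh^4 \<longrightarrow>
       (horizon_at {0<..} (bh_metric rh Q) r0 \<longleftrightarrow> r0 = r_plus rh Q \<or> r0 = r_minus rh Q)) \<and>
    (\<forall>rh. 0 < rh \<longrightarrow> Q^2 < rh^4 \<longrightarrow> 0 < r_minus rh Q \<and> r_minus rh Q < r_plus rh Q) \<and>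
    \<comment> \<open>coalescence of the horizons and extremality\<close>
    (\<forall>rh. 0 < rh \<longrightarrow> Q^2 \<le> rh^4 \<longrightarrow> (r_plus rh Q = r_minus rh Q \<longleftrightarrow> \<bar>Q\<bar> = rh^2)) \<and>
    (\<forall>rh. 0 < rh \<longrightarrow> Q = rh^2 \<longrightarrow> extremal {0<..} (bh_metric rh Q)) \<and>
    (\<forall>rh t r x y dt dr dx dy.
       0 < rh \<longrightarrow> Q = rh^2 \<longrightarrow> 0 < r \<longrightarrow> 1 - rh^2 / (2 * r^2) \<noteq> 0 \<longrightarrow>
       line_element (bh_metric rh Q) (vector [t, r, x, y]) (vector [dt, dr, dx, dy]) =
         - (r^2 * (1 - rh^2 / (2 * r^2))^2) * dt^2
         + dr^2 / (1 - rh^2 / (2 * r^2))^2 + r^2 * (dx^2 + dy^2))"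
proof -
  have "Q \<noteq> 0"
    using assms(1,3) by (auto simp: Q_def)
  have posI: "0 < r" if "r \<in> I" for r
    using that \<open>I \<subseteq> {0<..}\<close> by auto
  define f where "f = (\<lambda>r. 1 / a r)"
  define f' where "f' = (\<lambda>r. - deriv a r / (a r)^2)"
  define f'' where "f'' = (\<lambda>r. - (deriv (deriv a) r * a r - 2 * (deriv a r)^2) / (a r)^3)"
  have ansatz: "radial_ansatz I f f' f'' a b"
  proof
    fix r assume r: "r \<in> I"
    have da: "(a has_real_derivative deriv a r) (at r)"
      "(deriv a has_real_derivative deriv (deriv a) r) (at r)"
      using assms(9,10) r by (auto simp: DERIV_deriv_iff_real_differentiable)
    have "a r \<noteq> 0" using assms r by auto
    show "(f has_real_derivative f' r) (at r)"
      unfolding f_def f'_def using \<open>a r \<noteq> 0\<close>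
      by (auto intro!: derivative_eq_intros da simp: power2_eq_square)
    show "(f' has_real_derivative f'' r) (at r)"
      unfolding f'_def f''_def using \<open>a r \<noteq> 0\<close>
      by (auto intro!: derivative_eq_intros da simp: field_simps power_numeral_reduce)
  qed (use assms posI in \<open>auto simp: f_def\<close>)
  let ?g = "static_metric a b" and ?A = "gauge_potential k \<gamma> C"
  have P1: "\<forall>p\<in>radial_domain I. maxwell_eq \<gamma> ?g ?A (dilaton k) p"
    using maxwell_gauge_potential[OF ansatz] assms by (auto simp: radial_domain_def)
  have eqs: "(\<forall>p\<in>radial_domain I. einstein_eq k \<gamma> ?g ?A (dilaton k) p \<and> scalar_eq k \<gamma> ?g ?A (dilaton k) p)
      \<longleftrightarrow> \<gamma> = - 1 \<and> (\<exists>c. \<forall>r\<in>I. f r = blackening_c c Q r)" (is "?E \<longleftrightarrow> _")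
  proof
    assume E: ?E
    have ode: "\<gamma> = - 1" "2 * f r + r * f' r = 2 - Q^2 / (2 * r^4)" if "r \<in> I" for r
      \<comment> \<open>The reduced equations involve only the radius, so one point represents each
        \<open>r\<close>.\<close>
      using field_eqs_gauge_potential_iff[OF ansatz assms(1,2) _ assms(3) Q_def, of "vector [0, r, 0, 0]"]
        E that by (auto simp: radial_domain_def Let_def)
    obtain c where "\<And>r. r \<in> I \<Longrightarrow> f r = blackening_c c Q r"
      using blackening_c_unique[OF assms(5,6,8) radial_ansatz.f_deriv[OF ansatz] ode(2)] by blast
    then show "\<gamma> = - 1 \<and> (\<exists>c. \<forall>r\<in>I. f r = blackening_c c Q r)"
      using ode(1) \<open>I \<noteq> {}\<close> by blast
  next
    assume R: "\<gamma> = - 1 \<and> (\<exists>c. \<forall>r\<in>I. f r = blackening_c c Q r)"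
    then obtain c where c: "\<And>r. r \<in> I \<Longrightarrow> f r = blackening_c c Q r" by blast
    \<comment> \<open>The explicit profile replaces \<open>f\<close>, so that its derivatives take
      the closed forms for which both reduced equations are verified.\<close>
    have "radial_ansatz I (blackening_c c Q) (\<lambda>r. 2 * c / r^3 - Q^2 / r^5)
        (\<lambda>r. - 6 * c / r^4 + 5 * Q^2 / r^6) a b"
      using assms c[symmetric] by (intro radial_ansatz_blackening) (auto simp: f_def)
    then show ?E
      using is_solution_blackening_charged[OF _ assms(1,3) Q_def] R unfolding is_solution_def by blast
  qed
  have cplx: "(\<exists>c. \<forall>r\<in>I. f r = blackening_c c Q r) \<longleftrightarrow>
      (\<exists>rh :: complex. \<forall>r\<in>I.
           complex_of_real (a r)
             = 1 / (1 - rh^2 / of_real (r^2) + of_real (Q^2 / (4 * r^4))) \<and>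
           complex_of_real (b r)
             = of_real (r^2) * (1 - rh^2 / of_real (r^2) + of_real (Q^2 / (4 * r^4))))"
    (is "_ \<longleftrightarrow> (\<exists>rh. \<forall>r\<in>I. ?P rh r)")
  proof
    assume "\<exists>c. \<forall>r\<in>I. f r = blackening_c c Q r"
    then obtain c where c: "\<And>r. r \<in> I \<Longrightarrow> f r = blackening_c c Q r" by blast
    \<comment> \<open>Any real \<open>c\<close>, negative ones included, is the square of this
      complex \<open>rh\<close>.\<close>
    have "?P (csqrt (of_real c)) r" if "r \<in> I" for r
    proof -
      have z: "1 - (csqrt (of_real c))^2 / of_real (r^2) + of_real (Q^2 / (4 * r^4)) = complex_of_real (f r)"
        by (simp add: c[OF that] blackening_c_def)
      show ?thesis
        unfolding z using assms that by (simp add: f_def)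
    qed
    then show "\<exists>rh. \<forall>r\<in>I. ?P rh r" by blast
  next
    assume "\<exists>rh. \<forall>r\<in>I. ?P rh r"
    then obtain rh where rh: "\<And>r. r \<in> I \<Longrightarrow> ?P rh r" by blast
    \<comment> \<open>All other quantities are real, so taking real parts keeps only
      \<open>Re (rh^2)\<close> as the integration constant.\<close>
    have "f r = blackening_c (Re (rh^2)) Q r" if "r \<in> I" for r
    proof -
      have "complex_of_real (f r) = 1 / complex_of_real (a r)"
        by (simp add: f_def)
      also have "\<dots> = 1 - rh^2 / of_real (r^2) + of_real (Q^2 / (4 * r^4))"
        using rh[OF that] by simp
      finally have "f r = Re (1 - rh^2 / of_real (r^2) + of_real (Q^2 / (4 * r^4)))"
        by (metis Re_complex_of_real)
      then show ?thesis
        by (simp only: blackening_c_def plus_complex.simps minus_complex.simps Re_divide_of_real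
          Re_complex_of_real one_complex.simps)
    qed
    then show "\<exists>c. \<forall>r\<in>I. f r = blackening_c c Q r" by blast
  qed
  have P3: "\<exists>rh>0. \<forall>r\<in>I. a r = 1 / (1 - rh^2 / r^2 + Q^2 / (4 * r^4)) \<and>
                    b r = r^2 * (1 - rh^2 / r^2 + Q^2 / (4 * r^4))"
    if sol: "is_solution k \<gamma> (radial_domain I) ?g ?A (dilaton k)"
      and hor: "\<exists>r0. horizon_at I ?g r0"
  proof -
    obtain c where c: "\<And>r. r \<in> I \<Longrightarrow> f r = blackening_c c Q r"
      using sol eqs unfolding is_solution_def by blast
    obtain r0 where r0: "horizon_at I ?g r0" using hor by blast
    then have "0 < r0" and nt: "at r0 within I \<noteq> bot"
      by (auto simp: horizon_at_def trivial_limit_within)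
    \<comment> \<open>The horizon may lie outside \<open>I\<close>, where \<open>a\<close> is
      unconstrained; the continuous extension \<open>blackening_c\<close> supplies the limit. Its
      vanishing at \<open>r0\<close> writes \<open>c\<close> as a positive sum, and
      \<open>rh = sqrt c\<close>.\<close>
    have "((\<lambda>r. - (r^2 * blackening_c c Q r)) \<longlongrightarrow> - (r0^2 * blackening_c c Q r0)) (at r0 within I)"
      using \<open>0 < r0\<close> by (auto intro!: tendsto_intros tendsto_blackening_c)
    moreover have "((\<lambda>r. - (r^2 * blackening_c c Q r)) \<longlongrightarrow> 0) (at r0 within I)"
    proof (rule Lim_transform_within)
      show "((\<lambda>r. ?g (vector [0, r, 0, 0]) $ 1 $ 1) \<longlongrightarrow> 0) (at r0 within I)"
        using r0 unfolding horizon_at_def by blast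
      show "?g (vector [0, r, 0, 0]) $ 1 $ 1 = - (r^2 * blackening_c c Q r)" if "r \<in> I" for r
        using assms that c[OF that, symmetric] by (simp add: static_metric_nth f_def)
    qed (rule zero_less_one)
    ultimately have "- (r0^2 * blackening_c c Q r0) = 0"
      using tendsto_unique[OF nt] by blast
    moreover have "- (r0^2 * blackening_c c Q r0) = 0 \<longleftrightarrow> c = r0^2 + Q^2 / (4 * r0^2)"
      using \<open>0 < r0\<close>
      by (intro eq_iff_of_diff_eq_mult[of _ _ 1])
        (auto simp: blackening_c_def field_simps power_numeral_reduce)
    ultimately have "c = r0^2 + Q^2 / (4 * r0^2)"
      by simp
    then have "0 < c"
      using \<open>0 < r0\<close> by (simp add: add_pos_nonneg)
    have "a r = 1 / blackening_c c Q r" "b r = r^2 * blackening_c c Q r" if "r \<in> I" for r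
      using assms that c[OF that, symmetric] by (simp_all add: f_def)
    then show ?thesis
      using \<open>0 < c\<close> by (intro exI[of _ "sqrt c"]) (simp add: blackening_c_def)
  qed
  have P4: "is_solution k (- 1) (radial_domain {r. 0 < r \<and> blackening rh Q r \<noteq> 0})
            (bh_metric rh Q) (gauge_potential k (- 1) C) (dilaton k)" for rh
    using is_solution_blackening_charged[OF _ assms(1,3) Q_def] radial_ansatz_bh_metric[of rh Q]
    unfolding bh_metric_def blackening_eq by blast
  have line: "line_element (bh_metric rh q) (vector [t, r, x, y]) (vector [dt, dr, dx, dy]) =
         - (r^2 * (1 - rh^2 / r^2 + q^2 / (4 * r^4))) * dt^2
         + dr^2 / (1 - rh^2 / r^2 + q^2 / (4 * r^4)) + r^2 * (dx^2 + dy^2)"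
    for rh q t r x y dt dr dx dy
    by (simp add: bh_metric_def line_element_static_metric blackening_def)
  have P6: "((\<lambda>q. line_element (bh_metric rh q) (vector [t, r, x, y]) (vector [dt, dr, dx, dy]))
          \<longlongrightarrow> - (r^2 * (1 - rh^2 / r^2)) * dt^2 + dr^2 / (1 - rh^2 / r^2)
               + r^2 * (dx^2 + dy^2)) (at 0)"
    if "0 < r" "1 - rh^2 / r^2 \<noteq> 0" for rh t r x y dt dr dx dy
    unfolding line using that by (auto intro!: tendsto_eq_intros)
  have P7: "is_solution k (- 1) (radial_domain {r. 0 < r \<and> 1 - rh^2 / r^2 \<noteq> 0})
            (static_metric (\<lambda>r. 1 / (1 - rh^2 / r^2)) (\<lambda>r. r^2 * (1 - rh^2 / r^2)))
            (\<lambda>_. 0) (dilaton k)" for rh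
  proof -
    have eq: "1 - rh^2 / r^2 = blackening_c (rh^2) 0 r" for r
      by (simp add: blackening_c_def)
    show ?thesis
      unfolding eq
      by (intro is_solution_blackening_uncharged radial_ansatz_blackening open_blackening_domain)
        (use assms in auto)
  qed
  \<comment> \<open>\<open>Q \<noteq> 0\<close> makes \<open>r_minus\<close> positive, hence an
    admissible horizon radius.\<close>
  have P8: "horizon_at {0<..} (bh_metric rh Q) r0 \<longleftrightarrow> r0 = r_plus rh Q \<or> r0 = r_minus rh Q"
    if "0 < rh" "Q^2 \<le> rh^4" for rh r0
    using horizon_at_bh_metric_iff[OF that] blackening_eq_0_iff[OF that]
      r_plus_minus_squares(4)[OF that] r_minus_pos[OF that \<open>Q \<noteq> 0\<close>] by metis
  have P9: "0 < r_minus rh Q \<and> r_minus rh Q < r_plus rh Q" if "0 < rh" "Q^2 < rh^4" for rh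
  proof -
    have le: "Q^2 \<le> rh^4" using that by simp
    have "0 < rh^2 * sqrt (1 - Q^2 / rh^4)"
      using that by (auto simp: divide_simps)
    then have "(r_minus rh Q)^2 < (r_plus rh Q)^2"
      using r_plus_minus_squares(3)[OF that(1) le] by simp
    then show ?thesis
      using r_minus_pos[OF that(1) le \<open>Q \<noteq> 0\<close>] r_plus_minus_squares(4)[OF that(1) le]
      by (simp add: power_less_imp_less_base)
  qed
  have P10: "r_plus rh Q = r_minus rh Q \<longleftrightarrow> \<bar>Q\<bar> = rh^2" if "0 < rh" "Q^2 \<le> rh^4" for rh
  proof
    assume "r_plus rh Q = r_minus rh Q"
    then have "\<not> Q^2 < rh^4" using P9[OF that(1)] by auto
    then have "Q^2 = (rh^2)^2" using that by (simp add: power_mult[symmetric])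
    then have "Q = rh^2 \<or> Q = - (rh^2)" by (simp only: power2_eq_iff)
    then show "\<bar>Q\<bar> = rh^2" by auto
  next
    assume "\<bar>Q\<bar> = rh^2"
    then have "Q^2 = rh^4" by (metis power2_abs power_mult mult_2 numeral_Bit0)
    then show "r_plus rh Q = r_minus rh Q"
      using that by (simp add: r_plus_def r_minus_def)
  qed
  have P11: "extremal {0<..} (bh_metric rh Q)" if "0 < rh" "Q = rh^2" for rh
  proof -
    have Q4: "Q^2 = rh^4" using that by simp
    have rp: "r_plus rh Q = rh / sqrt 2" "r_minus rh Q = rh / sqrt 2"
      using that by (simp_all add: r_plus_def r_minus_def)
    have hor: "horizon_at {0<..} (bh_metric rh Q) r \<longleftrightarrow> r = rh / sqrt 2" for r
      using P8[OF that(1), of r] Q4 by (simp add: rp)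
    have "blackening rh Q (rh / sqrt 2) = 0"
      using horizon_at_bh_metric_iff[OF that(1), of Q "rh / sqrt 2"] hor[of "rh / sqrt 2"] Q4
      by simp
    then have "has_surface_gravity {0<..} (bh_metric rh Q) (rh / sqrt 2)
        \<bar>rh^2 / (rh / sqrt 2)^2 - Q^2 / (2 * (rh / sqrt 2)^4)\<bar>"
      using that Q4 by (intro has_surface_gravity_bh_metric) auto
    \<comment> \<open>Both terms equal 2: the two simple roots have merged into a double
      root.\<close>
    also have "\<bar>rh^2 / (rh / sqrt 2)^2 - Q^2 / (2 * (rh / sqrt 2)^4)\<bar> = 0"
      using that(1) Q4 by (simp add: power_divide power4_eq_xxxx)
    finally show ?thesis
      unfolding extremal_def hor by auto
  qed
  have P12: "line_element (bh_metric rh Q) (vector [t, r, x, y]) (vector [dt, dr, dx, dy]) =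
         - (r^2 * (1 - rh^2 / (2 * r^2))^2) * dt^2
         + dr^2 / (1 - rh^2 / (2 * r^2))^2 + r^2 * (dx^2 + dy^2)"
    if "Q = rh^2" "0 < r" for rh t r x y dt dr dx dy
  proof -
    have "1 - rh^2 / r^2 + Q^2 / (4 * r^4) = (1 - rh^2 / (2 * r^2))^2"
      using that by (simp add: field_simps power_numeral_reduce)
    then show ?thesis unfolding line by simp
  qed
  show ?thesis
    using P1 eqs cplx P3 P4 line P6 P7 P8 P9 P10 P11 P12 by auto
qed

end
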